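(* Let $e_1,e_2,e_3$ be nonzero integers with $e_1+e_2+e_3=0$ and $\gcd(e_1,e_2,e_3)\in\{1,2\}$. Let $n=p_1\cdots p_k$ be an odd positive square-free integer coprime with $e_1e_2e_3$, whose prime factors $p_i$ are quadratic residues modulo each odd prime factor of $e_1e_2e_3$. Assume that neither $E$ nor $E^{(n)}$ has a rational point of order $4$, and that every $p_i\equiv 1\pmod 8$. If $\mathrm{Sel}_2(E/\mathbb{Q})\cong(\mathbb{Z}/2\mathbb{Z})^2$, then every class of $\mathrm{Sel}_2'(E^{(n)})$ has a unique representative $(d_1,d_2,d_3)$ with each $d_i$ a positive divisor of $n$, and the map $(d_1,d_2,d_3)\mapsto\begin{pmatrix}\mathbf{x}\\ \mathbf{y}\end{pmatrix}$, where $\mathbf{x}=(v_{p_1}(d_1),\dots,v_{p_k}(d_1))^{\mathrm T}$ and $\mathbf{y}=(v_{p_1}(d_2),\dots,v_{p_k}(d_2))^{\mathrm T}$ in $\mathbb{F}_2^k$, induces an isomorphism of $\mathbb{F}_2$-vector spaces $$\mathrm{Sel}_2'(E^{(n)})\xrightarrow{\sim}\ker\begin{pmatrix}\mathbf{A}&\mathbf{O}\\ \mathbf{O}&\mathbf{A}\end{pmatrix}.$$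
   Context: For a nonzero integer $m$, $E^{(m)}$ is the elliptic curve $y^2=x(x-e_1m)(x+e_2m)$, $E=E^{(1)}$. For $\Lambda=(d_1,d_2,d_3)$ of nonzero square-free integers with $d_1d_2d_3$ a square, $D^{(m)}_\Lambda\subset\mathbb{P}^3$ (coordinates $(t,u_1,u_2,u_3)$) is defined by $e_1mt^2+d_2u_2^2-d_3u_3^2=0$, $e_2mt^2+d_3u_3^2-d_1u_1^2=0$, $e_3mt^2+d_1u_1^2-d_2u_2^2=0$. The 2-Selmer group $\mathrm{Sel}_2(E^{(m)}/\mathbb{Q})$ is identified with the group (under componentwise multiplication) of $\Lambda\in(\mathbb{Q}^\times/\mathbb{Q}^{\times2})^3$ with $d_1d_2d_3\in\mathbb{Q}^{\times2}$ and $D^{(m)}_\Lambda(\mathbb{A}_{\mathbb{Q}})\ne\emptyset$; the rational 2-torsion points of $E^{(m)}$ correspond to $(1,1,1)$, $(-e_3m,-e_1e_3,e_1m)$, $(-e_2e_3,e_3m,-e_2m)$, $(e_2m,-e_1m,-e_1e_2)$. The pure 2-Selmer group is $\mathrm{Sel}_2'(E^{(m)})=\mathrm{Sel}_2(E^{(m)}/\mathbb{Q})/(E^{(m)}(\mathbb{Q})_{\rm tors}/2E^{(m)}(\mathbb{Q})_{\rm tors})$ (when $E^{(m)}$ has no rational point of order $4$, this is the quotient by the subgroup of the four triples above). For a place $v$ and $\alpha,\beta\in\mathbb{Q}_v^\times$, $[\alpha,\beta]_v\in\mathbb{F}_2$ is the additive Hilbert symbol: $(\alpha,\beta)_v=(-1)^{[\alpha,\beta]_v}$.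 $\mathbf{A}=([p_j,-n]_{p_i})_{i,j}\in M_k(\mathbb{F}_2)$, $\mathbf{O}$ is the zero matrix. *)

theory Defs
  imports Complex_Main "HOL-Number_Theory.Number_Theory"
    "HOL-Computational_Algebra.Squarefree"
begin

(* A projective variety over Q given by homogeneous integral forms F (in the
   variables x 0, ..., x (N-1)) has a Q_p-point iff for every k there is a
   primitive integral vector solving all equations modulo p^k
   (Q_p-points of projective space = primitive Z_p-points, and compactness
   of Z_p^N). *)
definition padic_solvable :: "int \<Rightarrow> nat \<Rightarrow> ((nat \<Rightarrow> int) \<Rightarrow> int) list \<Rightarrow> bool" where
  "padic_solvable p N Fs \<longleftrightarrow>
     (\<forall>k::nat. \<exists>x::nat \<Rightarrow> int. (\<exists>i<N. \<not> p dvd x i) \<and> (\<forall>F\<in>set Fs. p ^ k dvd F x))"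

(* Hilbert symbol (a,b)_p at a finite prime p for nonzero integers a, b:
   (a,b)_p = 1 iff z^2 = a x^2 + b y^2 has a nontrivial solution over Q_p.
   Additive version [a,b]_p in F_2 = {0,1}. *)
definition hilbert_add :: "int \<Rightarrow> int \<Rightarrow> int \<Rightarrow> int" where
  "hilbert_add p a b =
     (if padic_solvable p 3 [\<lambda>x. a * (x 0)^2 + b * (x 1)^2 - (x 2)^2] then 0 else 1)"

definition on_curve :: "int \<Rightarrow> int \<Rightarrow> int \<Rightarrow> rat \<Rightarrow> rat \<Rightarrow> bool" where
  "on_curve e1 e2 m x y \<longleftrightarrow>
     y^2 = x * (x - of_int (e1*m)) * (x + of_int (e2*m))"

(* Doubling of an affine point P = (x,y), y \<noteq> 0, on y^2 = x^3 + A x^2 + B x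
   with A = (e2 - e1) m, B = - e1 e2 m^2 (group law with O at infinity). *)
definition dbl_x :: "int \<Rightarrow> int \<Rightarrow> int \<Rightarrow> rat \<Rightarrow> rat \<Rightarrow> rat" where
  "dbl_x e1 e2 m x y =
     (let A = of_int ((e2 - e1) * m); B = of_int (- e1 * e2 * m^2);
          l = (3 * x^2 + 2 * A * x + B) / (2 * y)
      in l^2 - A - 2 * x)"

definition dbl_y :: "int \<Rightarrow> int \<Rightarrow> int \<Rightarrow> rat \<Rightarrow> rat \<Rightarrow> rat" where
  "dbl_y e1 e2 m x y =
     (let A = of_int ((e2 - e1) * m); B = of_int (- e1 * e2 * m^2);
          l = (3 * x^2 + 2 * A * x + B) / (2 * y)
      in - (y + l * (dbl_x e1 e2 m x y - x)))"

(* E^(m)(Q) has a point of order 4: an affine rational point P with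
   P not 2-torsion (y \<noteq> 0) and 2P of order 2 (y-coordinate of 2P is 0). *)
definition has_rat_point_order4 :: "int \<Rightarrow> int \<Rightarrow> int \<Rightarrow> bool" where
  "has_rat_point_order4 e1 e2 m \<longleftrightarrow>
     (\<exists>x y. on_curve e1 e2 m x y \<and> y \<noteq> 0 \<and> dbl_y e1 e2 m x y = 0)"

(* the square-free integer representative of the class of a nonzero
   integer a in Q^x / Q^x2 *)
definition sqcl :: "int \<Rightarrow> int" where
  "sqcl a = (THE d. squarefree d \<and> (\<exists>s. s \<noteq> 0 \<and> a = d * s^2))"

type_synonym triple = "int \<times> int \<times> int"

definition tmul :: "triple \<Rightarrow> triple \<Rightarrow> triple" where
  "tmul L L' = (case L of (a1,a2,a3) \<Rightarrow> case L' of (b1,b2,b3) \<Rightarrow>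
                 (sqcl (a1*b1), sqcl (a2*b2), sqcl (a3*b3)))"

(* coordinates (t,u1,u2,u3) = (x 0, x 1, x 2, x 3); e3 = -e1-e2 *)
definition D_eqs :: "int \<Rightarrow> int \<Rightarrow> int \<Rightarrow> int \<Rightarrow> triple \<Rightarrow> ((nat \<Rightarrow> int) \<Rightarrow> int) list" where
  "D_eqs e1 e2 e3 m L = (case L of (d1,d2,d3) \<Rightarrow>
     [\<lambda>x. e1*m*(x 0)^2 + d2*(x 2)^2 - d3*(x 3)^2,
      \<lambda>x. e2*m*(x 0)^2 + d3*(x 3)^2 - d1*(x 1)^2,
      \<lambda>x. e3*m*(x 0)^2 + d1*(x 1)^2 - d2*(x 2)^2])"

definition D_real_solvable :: "int \<Rightarrow> int \<Rightarrow> int \<Rightarrow> int \<Rightarrow> triple \<Rightarrow> bool" where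
  "D_real_solvable e1 e2 e3 m L = (case L of (d1,d2,d3) \<Rightarrow>
     (\<exists>t u1 u2 u3 :: real. (t,u1,u2,u3) \<noteq> (0,0,0,0) \<and>
        e1*m*t^2 + d2*u2^2 - d3*u3^2 = 0 \<and>
        e2*m*t^2 + d3*u3^2 - d1*u1^2 = 0 \<and>
        e3*m*t^2 + d1*u1^2 - d2*u2^2 = 0))"

definition D_adelic_solvable :: "int \<Rightarrow> int \<Rightarrow> int \<Rightarrow> int \<Rightarrow> triple \<Rightarrow> bool" where
  "D_adelic_solvable e1 e2 e3 m L \<longleftrightarrow>
     D_real_solvable e1 e2 e3 m L \<and>
     (\<forall>p::int. prime p \<longrightarrow> padic_solvable p 4 (D_eqs e1 e2 e3 m L))"

(* Sel_2(E^(m)/Q), with classes represented by square-free integer triples *)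
definition Sel2 :: "int \<Rightarrow> int \<Rightarrow> int \<Rightarrow> int \<Rightarrow> triple set" where
  "Sel2 e1 e2 e3 m = {(d1,d2,d3). d1 \<noteq> 0 \<and> d2 \<noteq> 0 \<and> d3 \<noteq> 0 \<and>
      squarefree d1 \<and> squarefree d2 \<and> squarefree d3 \<and>
      (\<exists>s::int. d1*d2*d3 = s^2) \<and> D_adelic_solvable e1 e2 e3 m (d1,d2,d3)}"

(* image of the rational 2-torsion of E^(m) *)
definition tors2 :: "int \<Rightarrow> int \<Rightarrow> int \<Rightarrow> int \<Rightarrow> triple set" where
  "tors2 e1 e2 e3 m = {(1,1,1),
      (sqcl (-e3*m), sqcl (-e1*e3), sqcl (e1*m)),
      (sqcl (-e2*e3), sqcl (e3*m), sqcl (-e2*m)),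
      (sqcl (e2*m), sqcl (-e1*m), sqcl (-e1*e2))}"

(* the class of L in Sel_2'(E^(m)) = Sel_2 / (image of 2-torsion) *)
definition pure_class :: "int \<Rightarrow> int \<Rightarrow> int \<Rightarrow> int \<Rightarrow> triple \<Rightarrow> triple set" where
  "pure_class e1 e2 e3 m L = (\<lambda>T. tmul L T) ` tors2 e1 e2 e3 m"

definition matA :: "int list \<Rightarrow> nat \<Rightarrow> nat \<Rightarrow> int" where
  "matA ps i j = hilbert_add (ps ! i) (ps ! j) (- prod_list ps)"

definition matAA :: "int list \<Rightarrow> nat \<Rightarrow> nat \<Rightarrow> int" where
  "matAA ps i j = (let k = length ps in
     if i < k \<and> j < k then matA ps i j
     else if k \<le> i \<and> k \<le> j then matA ps (i - k) (j - k) else 0)"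

definition kerAA :: "int list \<Rightarrow> (nat \<Rightarrow> int) set" where
  "kerAA ps = {z. (\<forall>i. z i \<in> {0,1}) \<and> (\<forall>i\<ge>2*length ps. z i = 0) \<and>
       (\<forall>i<2*length ps. even (\<Sum>j<2*length ps. matAA ps i j * z j))}"

definition vecmap :: "int list \<Rightarrow> triple \<Rightarrow> (nat \<Rightarrow> int)" where
  "vecmap ps L = (case L of (d1,d2,d3) \<Rightarrow> (\<lambda>i.
     if i < length ps then int (multiplicity (ps ! i) d1 mod 2)
     else if i < 2 * length ps then int (multiplicity (ps ! (i - length ps)) d2 mod 2)
     else 0))"

definition F2add :: "(nat \<Rightarrow> int) \<Rightarrow> (nat \<Rightarrow> int) \<Rightarrow> (nat \<Rightarrow> int)" where
  "F2add z w = (\<lambda>i. (z i + w i) mod 2)"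

end

(*
  For p | n the hypotheses make every divisor of e1 e2 e3 a square in Q_p, and at the places
  dividing 2 e1 e2 e3 (and at infinity) every positive divisor of n is a square.  Splitting off the
  part of a Selmer triple of E^(n) coprime to n therefore gives a Selmer triple of E = E^(1), hence
  the triple of a 2-torsion point; multiplying by the corresponding torsion triple of E^(n) leaves a
  triple of positive divisors of n.  For such a triple the covering is trivially solvable at the
  places dividing 2 e1 e2 e3 and at infinity, and at all primes of good reduction; at p | n it is
  solvable iff the triple is locally one of (1,1,1), (n,1,n), (1,n,n), (n,n,1), i.e. iff d1 and d2
  are norms from Q_p(sqrt(-n)), which is the kernel condition.
*)
theory Submission
  imports Defs "HOL-Computational_Algebra.Nth_Powers"
begin

section \<open>Quadratic residues and square roots modulo prime powers\<close>

text \<open>The local answer at p | n is forced by size. For odd p the group E^(n)(Q_p)/2E^(n)(Q_p)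
  has as many elements as the 2-torsion, namely 4. Since -1 and the e_i are squares in Q_p, the
  torsion triples become the four listed ones, and they are distinct because n has odd valuation, so
  they fill the local image. The norms from Q_p(sqrt(-n)) have index 2 and contain n, the norm of
  sqrt(-n), so modulo squares they are {1, n}. Hence the condition splits into one on d1 and one on
  d2, and the matrix is block diagonal. The code checks all this by congruences modulo p^2; in the
  other direction, square roots modulo all p^k are lifted explicitly.

  Globally, a 2-torsion point of E with trivial triple would be twice a rational point. As E has no
  rational point of order 4, its torsion triples are distinct and exhaust a Selmer group of order 4.
  The same distinctness gives uniqueness of the representative: only one torsion translate removes
  the part coprime to n.\<close>

lemma Legendre_cases: "Legendre a p = 0 \<or> Legendre a p = 1 \<or> Legendre a p = -1"
  by (simp add: Legendre_def)

lemma Legendre_eq_0_iff: "Legendre a p = 0 \<longleftrightarrow> p dvd a"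
  by (simp add: Legendre_def cong_0_iff)

lemma Legendre_eq_1_iff: "Legendre a p = 1 \<longleftrightarrow> \<not> p dvd a \<and> QuadRes p a"
  by (simp add: Legendre_def cong_0_iff)

lemma Legendre_cong:
  assumes "[a = b] (mod p)"
  shows "Legendre a p = Legendre b p"
proof -
  have "p dvd a \<longleftrightarrow> p dvd b" using assms by (rule cong_dvd_iff)
  moreover have "QuadRes p a \<longleftrightarrow> QuadRes p b"
    unfolding QuadRes_def using assms by (meson cong_sym cong_trans)
  ultimately show ?thesis by (simp add: Legendre_def cong_0_iff)
qed

lemma odd_prime_gt_2: "prime (p::int) \<Longrightarrow> odd p \<Longrightarrow> p > 2"
  using prime_ge_2_int[of p] by (cases "p = 2") auto

text \<open>Euler's criterion makes both sides congruent modulo p. They differ by at most 2, and p >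
  2, so they are equal.\<close>

lemma Legendre_mult:
  fixes p :: int
  assumes p: "prime p" "odd p"
  shows "Legendre (a * b) p = Legendre a p * Legendre b p"
proof -
  define q where "q = nat p"
  have p2: "p > 2" using odd_prime_gt_2[OF p] .
  have q: "prime q" "2 < q" "int q = p"
    using p p2 by (auto simp: q_def)
  have E: "[Legendre x p = x ^ ((q - 1) div 2)] (mod p)" for x
    using euler_criterion[OF q(1,2), of x] q(3) by simp
  have "[Legendre (a * b) p = Legendre a p * Legendre b p] (mod p)"
    using cong_trans[OF E[of "a * b", unfolded power_mult_distrib]
        cong_sym[OF cong_mult[OF E[of a] E[of b]]]] .
  hence d: "p dvd Legendre (a * b) p - Legendre a p * Legendre b p"
    by (simp add: cong_iff_dvd_diff)
  have "\<bar>Legendre (a * b) p - Legendre a p * Legendre b p\<bar> \<le> 2"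
    using Legendre_cases[of "a*b" p] Legendre_cases[of a p] Legendre_cases[of b p] by auto
  with d p2 have "Legendre (a * b) p - Legendre a p * Legendre b p = 0"
    using zdvd_imp_le[of p "\<bar>Legendre (a * b) p - Legendre a p * Legendre b p\<bar>"]
    by (cases "Legendre (a * b) p - Legendre a p * Legendre b p = 0") auto
  thus ?thesis by simp
qed

lemma Legendre_square: "prime p \<Longrightarrow> \<not> p dvd a \<Longrightarrow> Legendre (a^2) p = 1"
  by (auto simp: Legendre_eq_1_iff QuadRes_def prime_dvd_power_iff intro: exI[of _ a])

lemma Legendre_1: "prime (p::int) \<Longrightarrow> Legendre 1 p = 1"
  using Legendre_square[of p 1] not_prime_unit[of p] by auto

lemma square_mod_prime_power:
  fixes p a :: int
  assumes p: "prime p" "odd p" and L: "Legendre a p = 1"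
  shows "\<exists>s. [s^2 = a] (mod p^k)"
proof (induction k)
  case 0
  show ?case by simp
next
  case (Suc k)
  from L have na: "\<not> p dvd a" by (simp add: Legendre_eq_1_iff)
  show ?case
  proof (cases "k = 0")
    case True
    with L show ?thesis by (auto simp: Legendre_eq_1_iff QuadRes_def)
  next
    case False
    from Suc obtain s where s: "[s^2 = a] (mod p^k)" by blast
    then obtain c where c: "s^2 - a = p^k * c" by (auto simp: cong_iff_dvd_diff dvd_def)
    have "\<not> p dvd s"
    proof
      assume "p dvd s"
      hence "p dvd s^2" by (simp add: power2_eq_square)
      moreover have "p dvd p^k * c" using False by (simp add: dvd_power)
      ultimately have "p dvd s^2 - p^k * c" by (rule dvd_diff)
      with c na show False by (simp add: algebra_simps)
    qed
    hence "\<not> p dvd 2 * s"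
      using p primes_dvd_imp_eq[of p 2] by (auto simp: prime_dvd_mult_iff)
    hence "coprime (2 * s) p" using p(1) prime_imp_coprime coprime_commute by blast
    then obtain i where i: "[2 * s * i = 1] (mod p)" using cong_solve_coprime_int by blast
    \<comment> \<open>Newton step: \<open>t\<close> solves c + 2 s t = 0 modulo p, so replacing s by
      s + p^k t removes the error p^k c modulo p^(k+1). The quadratic term p^(2k) t^2 is harmless
      because k >= 1, which is what \<open>k'\<close> records.\<close>
    define t where "t = - (c * i)"
    have "p dvd c + 2 * s * t"
    proof -
      have "p dvd c * (1 - 2 * s * i)"
        using i by (metis cong_iff_dvd_diff cong_sym dvd_mult)
      thus ?thesis by (simp add: t_def algebra_simps)
    qed
    then obtain e where e: "c + 2 * s * t = p * e" by (auto simp: dvd_def)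
    obtain k' where k': "k = Suc k'" using False by (cases k) auto
    have "(s + p^k * t)^2 - a = p^k * c + 2 * s * p^k * t + p^k * p^k * t^2"
      using c by (simp add: power2_eq_square algebra_simps)
    also have "\<dots> = p^k * (c + 2 * s * t) + p^k * p^k * t^2" by (simp add: algebra_simps)
    also have "\<dots> = p^Suc k * (e + p^k' * t^2)"
      unfolding e by (simp add: k' algebra_simps)
    finally show ?thesis by (auto simp: cong_iff_dvd_diff intro!: exI[of _ "s + p^k * t"])
  qed
qed

lemma square_mod_two_power:
  fixes a :: int
  assumes a: "[a = 1] (mod 8)"
  shows "\<exists>s. [s^2 = a] (mod 2^k)"
proof -
  \<comment> \<open>The derivative 2s costs a factor 2, so the induction starts at modulus 8 and
    corrects s only by 2^(k+2) c. This changes s^2 by 2^(k+3) s c plus higher terms, and c + s c is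
    even because s is odd.\<close>
  have "\<exists>s. [s^2 = a] (mod 2^(k+3))"
  proof (induction k)
    case 0
    show ?case using a by (auto intro!: exI[of _ 1] simp: cong_sym)
  next
    case (Suc k)
    then obtain s where s: "[s^2 = a] (mod 2^(k+3))" by blast
    then obtain c where c: "s^2 - a = 2^(k+3) * c" by (auto simp: cong_iff_dvd_diff dvd_def)
    have "odd a" using a by (auto simp: cong_def) presburger
    moreover have "even (s^2 - a)" unfolding c by simp
    ultimately have "odd s" by simp
    hence "even (c + s * c)" by (cases "even c") auto
    then obtain e where e: "c + s * c = 2 * e" by (auto simp: dvd_def)
    have "(s + 2^(k+2) * c)^2 - a = 2^(k+3) * c + 2^(k+3) * s * c + 2^(k+4) * 2^k * c^2"
      using c by (simp add: power2_eq_square algebra_simps power_add)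
    also have "\<dots> = 2^(k+3) * (c + s * c) + 2^(k+4) * 2^k * c^2" by (simp add: algebra_simps)
    also have "\<dots> = 2^(Suc k + 3) * (e + 2^k * c^2)"
      unfolding e by (simp add: algebra_simps power_add)
    finally show ?case by (auto simp: cong_iff_dvd_diff intro!: exI[of _ "s + 2^(k+2) * c"])
  qed
  thus ?thesis by (meson cong_dvd_modulus le_add1 le_imp_power_dvd)
qed

text \<open>In Q_p the solution is sqrt(a b) / a; in the proof \<open>c\<close> stands for 1/a
  modulo p^k.\<close>

lemma scaled_square_mod_prime_power:
  fixes p a b :: int
  assumes p: "prime p" "odd p" and L: "Legendre (a * b) p = 1"
  shows "\<exists>u. p^k dvd a * u^2 - b"
proof -
  obtain s where s: "[s^2 = a * b] (mod p^k)" using square_mod_prime_power[OF p L] by blast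
  have "\<not> p dvd a" using L by (auto simp: Legendre_eq_1_iff)
  hence "coprime a (p^k)" using p(1) prime_imp_coprime coprime_commute by (metis coprime_power_right_iff)
  then obtain c where c: "[a * c = 1] (mod p^k)" using cong_solve_coprime_int by blast
  have "[a * (c * s)^2 = a * c^2 * (a * b)] (mod p^k)"
    using cong_mult[OF cong_refl[of "a * c^2"] s] by (simp add: power_mult_distrib mult_ac)
  also have "a * c^2 * (a * b) = (a * c)^2 * b" by (simp add: power2_eq_square mult_ac)
  also have "[(a * c)^2 * b = 1^2 * b] (mod p^k)" using c by (intro cong_mult cong_pow cong_refl)
  finally show ?thesis by (auto simp: cong_iff_dvd_diff)
qed

lemma Legendre_minus_1:
  fixes p :: int
  assumes p: "prime p" and c: "[p = 1] (mod 4)"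
  shows "Legendre (-1) p = 1"
proof -
  have o: "odd p" using c by (auto simp: cong_def) presburger
  define q where "q = nat p"
  have p2: "p > 2" using odd_prime_gt_2[OF p o] .
  have q: "prime q" "2 < q" "int q = p"
    using p p2 by (auto simp: q_def)
  have "[q = 1] (mod 4)" using c q(3) by (metis cong_int_iff of_nat_1 of_nat_numeral)
  hence "q mod 4 = 1" by (simp add: cong_def)
  hence "even ((q - 1) div 2)" by presburger
  hence "[Legendre (-1) p = 1] (mod p)"
    using euler_criterion[OF q(1,2), of "-1"] q(3) by simp
  hence "p dvd Legendre (-1) p - 1" by (simp add: cong_iff_dvd_diff)
  thus ?thesis using Legendre_cases[of "-1" p] p2 zdvd_imp_le[of p 1] zdvd_imp_le[of p 2] by auto
qed

text \<open>A primitive eighth root of unity \<open>y\<close> gives \<open>(y - y\<^sup>3)\<^sup>2 = 2\<close>.\<close>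

lemma Legendre_2:
  fixes p :: int
  assumes p: "prime p" and c: "[p = 1] (mod 8)"
  shows "Legendre 2 p = 1"
proof -
  have p81: "p mod 8 = 1" using c by (simp add: cong_def)
  hence o: "odd p" by presburger
  define q where "q = nat p"
  have p2: "p > 2" using odd_prime_gt_2[OF p o] .
  have q: "prime q" "2 < q" "int q = p"
    using p p2 by (auto simp: q_def)
  obtain g where g: "residue_primroot q g" using prime_primitive_root_exists[of q] q by (auto simp: prime_gt_1_nat)
  have q8: "q mod 8 = 1" using p81 q(3) by (metis of_nat_1 of_nat_eq_iff of_nat_mod of_nat_numeral)
  define y where "y = int g ^ ((q - 1) div 8)"
  have e: "(q - 1) div 8 * 4 = (q - 1) div 2" "(q-1) div 2 * 2 = q - 1" using q8 by presburger+
  define z where "z = int g ^ ((q - 1) div 2)"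
  have tot: "totient q = q - 1" using q(1) by (simp add: totient_prime)
  have co: "coprime q g" and ord: "ord q g = q - 1" using g tot by (auto simp: residue_primroot_def)
  have "z^2 = int (g ^ (q - 1))" unfolding z_def power_mult[symmetric] e by simp
  moreover have "[g ^ (q - 1) = 1] (mod q)" using ord_works[of g q] ord by simp
  ultimately have "[z^2 = 1] (mod p)" using q(3) by (metis cong_int_iff of_nat_1)
  hence "p dvd (z - 1) * (z + 1)" by (simp add: cong_iff_dvd_diff power2_eq_square algebra_simps)
  moreover have "\<not> p dvd z - 1"
  proof
    assume "p dvd z - 1"
    hence "[int (g ^ ((q - 1) div 2)) = int 1] (mod int q)"
      using q(3) by (simp add: z_def cong_iff_dvd_diff)
    hence "[g ^ ((q - 1) div 2) = 1] (mod q)" using cong_int_iff by blast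
    hence "ord q g dvd (q - 1) div 2" using ord_divides by blast
    hence "q - 1 \<le> (q - 1) div 2" using ord q(2) by (intro dvd_imp_le) auto
    thus False using q(2) by simp
  qed
  ultimately have "p dvd z + 1" using p by (simp add: prime_dvd_mult_iff)
  have "y^4 = z" unfolding y_def z_def power_mult[symmetric] e ..
  have "(y - y^3)^2 - 2 = (z + 1) * (y^2 - 2)"
    unfolding \<open>y^4 = z\<close>[symmetric] by (simp add: algebra_simps power2_eq_square power3_eq_cube power4_eq_xxxx)
  hence "[(y - y^3)^2 = 2] (mod p)" using \<open>p dvd z + 1\<close> by (simp add: cong_iff_dvd_diff)
  moreover have "\<not> p dvd 2" using p2 by (auto dest: zdvd_imp_le)
  ultimately show ?thesis by (auto simp: Legendre_eq_1_iff QuadRes_def)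
qed

text \<open>The hypotheses say that p is a residue modulo q, while the conditions at p need q to be
  a residue modulo p. For p = 1 modulo 4 the sign in quadratic reciprocity is +1.\<close>

lemma Legendre_flip:
  fixes p q :: int
  assumes p: "prime p" "[p = 1] (mod 4)" and q: "prime q" "odd q" and ne: "p \<noteq> q"
    and Q: "QuadRes q p"
  shows "Legendre q p = 1"
proof -
  have o: "odd p" using p(2) by (auto simp: cong_def) presburger
  have "p mod 4 = 1" using p(2) by (simp add: cong_def)
  hence ev: "even ((p - 1) div 2)" by presburger
  have gt: "p > 2" "q > 2" using odd_prime_gt_2 p q o by auto
  have "even (nat ((p - 1) div 2 * ((q - 1) div 2)))"
    using ev gt by (simp add: even_nat_iff pos_imp_zdiv_nonneg_iff)
  hence *: "Legendre p q * Legendre q p = 1"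
    using Quadratic_Reciprocity_int[of p q] p(1) q(1) gt ne by simp
  have "\<not> q dvd p" using p(1) q(1) ne primes_dvd_imp_eq by blast
  hence "Legendre p q = 1" using Q by (simp add: Legendre_eq_1_iff)
  with * show ?thesis by simp
qed

section \<open>Solvability of the coverings at primes of good reduction\<close>

lemma bij_betw_affine_mod:
  fixes p a b :: int
  assumes p: "p > 0" and a: "coprime a p"
  shows "bij_betw (\<lambda>x. (a * x + b) mod p) {0..<p} {0..<p}"
proof -
  have "inj_on (\<lambda>x. (a * x + b) mod p) {0..<p}"
  proof (rule inj_onI)
    fix x y assume x: "x \<in> {0..<p}" and y: "y \<in> {0..<p}" and "(a * x + b) mod p = (a * y + b) mod p"
    hence "[a * x + b = a * y + b] (mod p)" by (simp add: cong_def)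
    hence "[x = y] (mod p)" using a by (simp add: cong_add_rcancel cong_mult_lcancel)
    with x y show "x = y" by (simp add: cong_def)
  qed
  moreover have "(\<lambda>x. (a * x + b) mod p) ` {0..<p} \<subseteq> {0..<p}" using p by auto
  ultimately show ?thesis by (simp add: bij_betw_def endo_inj_surj)
qed

lemma sum_affine_mod:
  fixes p a b :: int and f :: "int \<Rightarrow> int"
  assumes "p > 0" "coprime a p" and f: "\<And>x. f (x mod p) = f x"
  shows "(\<Sum>x\<in>{0..<p}. f (a * x + b)) = (\<Sum>x\<in>{0..<p}. f x)"
  using sum.reindex_bij_betw[OF bij_betw_affine_mod[OF assms(1,2), of b], of f] by (simp add: f)

lemma Legendre_mod: "Legendre (x mod p) p = Legendre x p"
  by (rule Legendre_cong) (simp add: cong_def)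

text \<open>Multiplying the variable by the nonresidue \<open>g\<close> permutes the residues and
  changes the sign of the sum. Where the coverings are treated, \<open>g\<close> will be the entry
  d2.\<close>

lemma sum_Legendre:
  fixes p b :: int
  assumes p: "prime p" "odd p" and g: "Legendre g p = -1"
  shows "(\<Sum>x\<in>{0..<p}. Legendre (x + b) p) = 0"
proof -
  have p0: "p > 0" using p(1) by (simp add: prime_gt_0_int)
  have "\<not> p dvd g" using g Legendre_eq_0_iff[of g p] by auto
  hence "coprime g p" using p(1) prime_imp_coprime coprime_commute by blast
  hence "(\<Sum>x\<in>{0..<p}. Legendre (g * x + 0) p) = (\<Sum>x\<in>{0..<p}. Legendre x p)"
    by (intro sum_affine_mod p0 Legendre_mod)
  hence "- (\<Sum>x\<in>{0..<p}. Legendre x p) = (\<Sum>x\<in>{0..<p}. Legendre x p)"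
    by (simp add: Legendre_mult[OF p] g sum_negf)
  moreover have "(\<Sum>x\<in>{0..<p}. Legendre (1 * x + b) p) = (\<Sum>x\<in>{0..<p}. Legendre x p)"
    by (intro sum_affine_mod p0 Legendre_mod) simp
  ultimately show ?thesis by simp
qed

text \<open>The sum does not depend on the class of \<open>b \<noteq> 0\<close>, and averaging over all \<open>b\<close> gives \<open>0\<close>.\<close>

lemma sum_Legendre_shift:
  fixes p b :: int
  assumes p: "prime p" "odd p" and g: "Legendre g p = -1" and b: "\<not> p dvd b"
  shows "(\<Sum>x\<in>{0..<p}. Legendre x p * Legendre (x + b) p) = -1"
proof -
  define S where "S b = (\<Sum>x\<in>{0..<p}. Legendre x p * Legendre (x + b) p)" for b
  have p1: "p > 1" using p(1) by (simp add: prime_gt_1_int)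
  \<comment> \<open>Substituting c x for x takes the symbol of c out of both factors, and its square
    is 1.\<close>
  have S1: "S c = S 1" if c: "\<not> p dvd c" for c
  proof -
    have sq: "Legendre c p * Legendre c p = 1"
      using c Legendre_cases[of c p] by (auto simp: Legendre_eq_0_iff)
    have "coprime c p" using c p(1) prime_imp_coprime coprime_commute by blast
    moreover have "Legendre (x mod p) p * Legendre (x mod p + c) p = Legendre x p * Legendre (x + c) p" for x
      using Legendre_cong[of "x mod p + c" "x + c" p] by (simp add: Legendre_mod cong_def mod_simps)
    ultimately have "S c = (\<Sum>x\<in>{0..<p}. Legendre (c * x + 0) p * Legendre (c * x + 0 + c) p)"
      unfolding S_def using p1
        sum_affine_mod[of p c "\<lambda>x. Legendre x p * Legendre (x + c) p" 0] by simp
    also have "\<dots> = (\<Sum>x\<in>{0..<p}. (Legendre c p * Legendre c p) * (Legendre x p * Legendre (x + 1) p))"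
    proof (rule sum.cong, goal_cases)
      case (2 x)
      have "c * x + 0 + c = c * (x + 1)" by (simp add: algebra_simps)
      thus ?case by (simp only: Legendre_mult[OF p] add_0_right mult_ac)
    qed simp
    finally show ?thesis unfolding sq S_def by simp
  qed
  have sqsum: "S 0 = p - 1"
  proof -
    have "S 0 = (\<Sum>x\<in>{0..<p}. if x = 0 then 0 else 1)"
      unfolding S_def
    proof (rule sum.cong, goal_cases)
      case (2 x)
      show ?case
      proof (cases "x = 0")
        case False
        hence "\<not> p dvd x" using 2 by (auto dest: zdvd_imp_le)
        thus ?thesis using False Legendre_cases[of x p] by (auto simp: Legendre_eq_0_iff)
      qed (simp add: Legendre_def)
    qed simp
    also have "\<dots> = (\<Sum>x\<in>{1..<p}. 1)"
      by (rule sum.mono_neutral_cong_right) auto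
    finally show ?thesis using p1 by simp
  qed
  have "(\<Sum>b\<in>{0..<p}. S b) = (\<Sum>x\<in>{0..<p}. \<Sum>b\<in>{0..<p}. Legendre x p * Legendre (x + b) p)"
    unfolding S_def by (rule sum.swap)
  also have "\<dots> = (\<Sum>x\<in>{0..<p}. Legendre x p * (\<Sum>b\<in>{0..<p}. Legendre (b + x) p))"
    by (simp add: sum_distrib_left add.commute)
  also have "\<dots> = 0" by (simp add: sum_Legendre[OF p g])
  finally have tot: "(\<Sum>b\<in>{0..<p}. S b) = 0" .
  have "{0..<p} = insert 0 {1..<p}" using p1 by auto
  hence "(\<Sum>b\<in>{0..<p}. S b) = S 0 + (\<Sum>b\<in>{1..<p}. S b)" by simp
  also have "(\<Sum>b\<in>{1..<p}. S b) = (\<Sum>b\<in>{1..<p}. S 1)"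
    by (intro sum.cong refl S1) (auto dest: zdvd_imp_le)
  also have "\<dots> = (p - 1) * S 1" using p1 by simp
  finally have "(p - 1) + (p - 1) * S 1 = 0" using tot sqsum by simp
  hence "(p - 1) * (S 1 + 1) = 0" by (simp add: distrib_left)
  hence "S 1 = -1" using p1 by simp
  thus ?thesis using S1[OF b] by (simp add: S_def)
qed

lemma sum_Legendre_pair:
  fixes p r s :: int
  assumes p: "prime p" "odd p" and g: "Legendre g p = -1" and rs: "\<not> p dvd r - s"
  shows "(\<Sum>x\<in>{0..<p}. Legendre (x - r) p * Legendre (x - s) p) = -1"
proof -
  have p0: "p > 0" using p(1) by (simp add: prime_gt_0_int)
  have "Legendre (x mod p) p * Legendre (x mod p + (r - s)) p = Legendre x p * Legendre (x + (r - s)) p" for x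
    using Legendre_cong[of "x mod p + (r - s)" "x + (r - s)" p] by (simp add: Legendre_mod cong_def mod_simps)
  hence "(\<Sum>x\<in>{0..<p}. Legendre (1 * x + (- r)) p * Legendre (1 * x + (- r) + (r - s)) p)
      = (\<Sum>x\<in>{0..<p}. Legendre x p * Legendre (x + (r - s)) p)"
    by (intro sum_affine_mod p0) auto
  thus ?thesis using sum_Legendre_shift[OF p g rs] by (simp add: algebra_simps)
qed

text \<open>Comparing the count for signs \<open>(+,-,-)\<close> with the count for \<open>(+,+,+)\<close> makes the cubic
  character sum cancel, so no Hasse bound is needed.\<close>

lemma exists_Legendre_pattern:
  fixes p r1 r2 r3 :: int
  assumes p: "prime p" "odd p" and g: "Legendre g p = -1"
    and r: "\<not> p dvd r1 - r2" "\<not> p dvd r1 - r3"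
  shows "\<exists>x. Legendre (x - r1) p \<noteq> -1 \<and> Legendre (x - r2) p \<noteq> 1 \<and> Legendre (x - r3) p \<noteq> 1"
proof -
  define c where "c r x = Legendre (x - r) p" for r x
  define W where "W x = (1 + c r1 x) * (1 - c r2 x) * (1 - c r3 x)" for x
  define V where "V x = (1 + c r1 x) * (1 + c r2 x) * (1 + c r3 x)" for x
  have cc: "c r x = 0 \<or> c r x = 1 \<or> c r x = -1" for r x unfolding c_def by (rule Legendre_cases)
  have "sum W {0..<p} = (\<Sum>x\<in>{0..<p}. V x - 2 * c r2 x - 2 * c r3 x - 2 * (c r1 x * c r2 x) - 2 * (c r1 x * c r3 x))"
    unfolding W_def V_def by (simp add: algebra_simps)
  also have "\<dots> = sum V {0..<p} - 2 * (\<Sum>x\<in>{0..<p}. c r2 x) - 2 * (\<Sum>x\<in>{0..<p}. c r3 x)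
      - 2 * (\<Sum>x\<in>{0..<p}. c r1 x * c r2 x) - 2 * (\<Sum>x\<in>{0..<p}. c r1 x * c r3 x)"
    by (simp add: sum_subtractf sum_distrib_left)
  \<comment> \<open>The linear sums vanish and each of the two pair sums is -1; the terms in c r2 c
    r3 and in the triple product are common to \<open>W\<close> and \<open>V\<close>.\<close>
  also have "\<dots> = sum V {0..<p} + 4"
    using sum_Legendre[OF p g, of "-r2"] sum_Legendre[OF p g, of "-r3"]
      sum_Legendre_pair[OF p g r(1)] sum_Legendre_pair[OF p g r(2)] by (simp add: c_def)
  finally have W: "sum W {0..<p} = sum V {0..<p} + 4" .
  have "sum V {0..<p} \<ge> 0"
  proof (rule sum_nonneg)
    fix x
    show "V x \<ge> 0"
      using cc[of r1 x] cc[of r2 x] cc[of r3 x] unfolding V_def by (intro mult_nonneg_nonneg) auto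
  qed
  with W have "sum W {0..<p} > 0" by simp
  then obtain x where "W x > 0" using sum_nonpos[of "{0..<p}" W] by (meson not_le)
  \<comment> \<open>The value 0 remains possible: x may be a root modulo p. That case is repaired in
    \<open>padic_solvable_D_nonresidues\<close>.\<close>
  hence "c r1 x \<noteq> -1" "c r2 x \<noteq> 1" "c r3 x \<noteq> 1" by (auto simp: W_def)
  thus ?thesis by (auto simp: c_def)
qed

section \<open>Points on the coverings in terms of congruences\<close>

lemma padic_solvable_D_iff:
  "padic_solvable p 4 (D_eqs e1 e2 e3 m (d1,d2,d3)) \<longleftrightarrow>
     (\<forall>k. \<exists>t u1 u2 u3. (\<not> p dvd t \<or> \<not> p dvd u1 \<or> \<not> p dvd u2 \<or> \<not> p dvd u3) \<and>
        p^k dvd e1*m*t^2 + d2*u2^2 - d3*u3^2 \<and>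
        p^k dvd e2*m*t^2 + d3*u3^2 - d1*u1^2 \<and>
        p^k dvd e3*m*t^2 + d1*u1^2 - d2*u2^2)" (is "?l \<longleftrightarrow> (\<forall>k. ?r k)")
proof -
  have ex: "(\<exists>i<4. P i) \<longleftrightarrow> P 0 \<or> P 1 \<or> P 2 \<or> P (3::nat)" for P
    by (auto simp: numeral_eq_Suc less_Suc_eq)
  have "(\<exists>x. (\<exists>i<4. \<not> p dvd x i) \<and> (\<forall>F\<in>set (D_eqs e1 e2 e3 m (d1,d2,d3)). p ^ k dvd F x)) \<longleftrightarrow> ?r k" for k
  proof
    assume "?r k"
    then obtain t u1 u2 u3 where "\<not> p dvd t \<or> \<not> p dvd u1 \<or> \<not> p dvd u2 \<or> \<not> p dvd u3"
        "p^k dvd e1*m*t^2 + d2*u2^2 - d3*u3^2"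
        "p^k dvd e2*m*t^2 + d3*u3^2 - d1*u1^2"
        "p^k dvd e3*m*t^2 + d1*u1^2 - d2*u2^2" by blast
    thus "\<exists>x. (\<exists>i<4. \<not> p dvd x i) \<and> (\<forall>F\<in>set (D_eqs e1 e2 e3 m (d1,d2,d3)). p ^ k dvd F x)"
      by (intro exI[of _ "(!) [t, u1, u2, u3]"]) (simp add: ex D_eqs_def)
  next
    assume "\<exists>x. (\<exists>i<4. \<not> p dvd x i) \<and> (\<forall>F\<in>set (D_eqs e1 e2 e3 m (d1,d2,d3)). p ^ k dvd F x)"
    then obtain x where x: "\<exists>i<4. \<not> p dvd x i" "\<forall>F\<in>set (D_eqs e1 e2 e3 m (d1,d2,d3)). p ^ k dvd F x"
      by blast
    show "?r k"
      by (rule exI[of _ "x 0"], rule exI[of _ "x 1"], rule exI[of _ "x 2"], rule exI[of _ "x 3"])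
        (use x in \<open>simp add: ex D_eqs_def\<close>)
  qed
  thus ?thesis unfolding padic_solvable_def by (intro all_cong1)
qed

text \<open>Rotating the indices of e, d and u only permutes the three equations. Later case
  distinctions treat one position and reach the other two by this symmetry.\<close>

lemma padic_solvable_D_rotate:
  "padic_solvable p 4 (D_eqs e2 e3 e1 m (d2,d3,d1)) \<longleftrightarrow> padic_solvable p 4 (D_eqs e1 e2 e3 m (d1,d2,d3))"
  unfolding padic_solvable_D_iff by (intro all_cong1) blast

text \<open>With d_i = s_i^2 the covering has the point (0 : 1/s1 : 1/s2 : 1/s3) at t = 0, for every
  m. Multiplying by s1 s2 s3 gives the integral coordinates used here.\<close>

lemma padic_solvable_D_squares:
  assumes p: "prime p"
    and d: "\<not> p dvd d1" "\<not> p dvd d2" "\<not> p dvd d3"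
    and s: "\<And>k. \<exists>s. [s^2 = d1] (mod p^k)" "\<And>k. \<exists>s. [s^2 = d2] (mod p^k)" "\<And>k. \<exists>s. [s^2 = d3] (mod p^k)"
  shows "padic_solvable p 4 (D_eqs e1 e2 e3 m (d1,d2,d3))"
  unfolding padic_solvable_D_iff
proof
  fix k
  \<comment> \<open>The exponent \<open>Suc k\<close> keeps a congruence modulo p even for k = 0; it
    is needed to see that the roots are units.\<close>
  obtain s1 s2 s3 where s: "[s1^2 = d1] (mod p^(Suc k))" "[s2^2 = d2] (mod p^(Suc k))" "[s3^2 = d3] (mod p^(Suc k))"
    using s by metis
  have nd: "\<not> p dvd s" if "[s^2 = d] (mod p^Suc k)" "\<not> p dvd d" for s d
  proof
    assume "p dvd s"
    hence "p dvd s^2" by (simp add: power2_eq_square)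
    moreover have "[s^2 = d] (mod p)" using that(1) by (rule cong_dvd_modulus) simp
    ultimately show False using that(2) cong_dvd_iff by blast
  qed
  have P: "[d1 * (s2*s3)^2 = d1*d2*d3] (mod p^k)" "[d2 * (s1*s3)^2 = d1*d2*d3] (mod p^k)"
       "[d3 * (s1*s2)^2 = d1*d2*d3] (mod p^k)"
  proof -
    have s': "[s1^2 = d1] (mod p^k)" "[s2^2 = d2] (mod p^k)" "[s3^2 = d3] (mod p^k)"
      using s by (auto elim!: cong_dvd_modulus)
    show "[d1 * (s2*s3)^2 = d1*d2*d3] (mod p^k)"
      using cong_mult[OF cong_refl[of d1] cong_mult[OF s'(2,3)]] by (simp add: power_mult_distrib mult_ac)
    show "[d2 * (s1*s3)^2 = d1*d2*d3] (mod p^k)"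
      using cong_mult[OF cong_refl[of d2] cong_mult[OF s'(1,3)]] by (simp add: power_mult_distrib mult_ac)
    show "[d3 * (s1*s2)^2 = d1*d2*d3] (mod p^k)"
      using cong_mult[OF cong_refl[of d3] cong_mult[OF s'(1,2)]] by (simp add: power_mult_distrib mult_ac)
  qed
  have "\<not> p dvd s2 * s3" using nd[OF s(2) d(2)] nd[OF s(3) d(3)] p by (simp add: prime_dvd_mult_iff)
  moreover have "p^k dvd d2 * (s1*s3)^2 - d3 * (s1*s2)^2" "p^k dvd d3 * (s1*s2)^2 - d1 * (s2*s3)^2"
     "p^k dvd d1 * (s2*s3)^2 - d2 * (s1*s3)^2"
    using P by (metis cong_iff_dvd_diff cong_sym cong_trans)+
  ultimately show "\<exists>t u1 u2 u3. (\<not> p dvd t \<or> \<not> p dvd u1 \<or> \<not> p dvd u2 \<or> \<not> p dvd u3) \<and>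
        p^k dvd e1*m*t^2 + d2*u2^2 - d3*u3^2 \<and>
        p^k dvd e2*m*t^2 + d3*u3^2 - d1*u1^2 \<and>
        p^k dvd e3*m*t^2 + d1*u1^2 - d2*u2^2"
    by (intro exI[of _ 0] exI[of _ "s2*s3"] exI[of _ "s1*s3"] exI[of _ "s1*s2"]) simp
qed

text \<open>With \<open>t = 1\<close>, a point of the covering is a common value \<open>x\<close> of \<open>\<rho>\<^sub>i + d\<^sub>i u\<^sub>i\<^sup>2\<close>, where
  \<open>\<rho> = (-e\<^sub>2 m, e\<^sub>1 m, 0)\<close> are the abscissae of the 2-torsion points.\<close>

lemma padic_solvable_D_affine:
  assumes p: "prime p" "odd p" and e: "e1 + e2 + e3 = 0"
    and x: "x = - e2 * m \<or> Legendre (d1 * (x + e2 * m)) p = 1"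
           "x = e1 * m \<or> Legendre (d2 * (x - e1 * m)) p = 1"
           "x = 0 \<or> Legendre (d3 * x) p = 1"
  shows "padic_solvable p 4 (D_eqs e1 e2 e3 m (d1,d2,d3))"
  unfolding padic_solvable_D_iff
proof
  fix k
  have L: "\<exists>u. p^k dvd d * u^2 - y" if "y = 0 \<or> Legendre (d * y) p = 1" for d y
    using that scaled_square_mod_prime_power[OF p, of d y k] by (auto intro: exI[of _ 0])
  obtain u1 u2 u3 where u: "p^k dvd d1 * u1^2 - (x + e2 * m)" "p^k dvd d2 * u2^2 - (x - e1 * m)"
     "p^k dvd d3 * u3^2 - x"
    using L[of "x + e2 * m" d1] L[of "x - e1 * m" d2] L[of x d3] x by auto
  have e3: "e3 = - e1 - e2" using e by simp
  have "p^k dvd e1*m*1^2 + d2*u2^2 - d3*u3^2" using dvd_diff[OF u(2) u(3)] by (simp add: algebra_simps)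
  moreover have "p^k dvd e2*m*1^2 + d3*u3^2 - d1*u1^2" using dvd_diff[OF u(3) u(1)] by (simp add: algebra_simps)
  moreover have "p^k dvd e3*m*1^2 + d1*u1^2 - d2*u2^2" using dvd_diff[OF u(1) u(2)] by (simp add: algebra_simps e3)
  moreover have "\<not> p dvd 1" using p(1) not_prime_unit by blast
  ultimately show "\<exists>t u1 u2 u3. (\<not> p dvd t \<or> \<not> p dvd u1 \<or> \<not> p dvd u2 \<or> \<not> p dvd u3) \<and>
        p^k dvd e1*m*t^2 + d2*u2^2 - d3*u3^2 \<and>
        p^k dvd e2*m*t^2 + d3*u3^2 - d1*u1^2 \<and>
        p^k dvd e3*m*t^2 + d1*u1^2 - d2*u2^2"
    by blast
qed

text \<open>An affine point needs an x for which d1 (x + e2 m), d2 (x - e1 m) and d3 x are squares.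
  Modulo p this asks for the character pattern (+,-,-), which exists by counting.\<close>

lemma padic_solvable_D_nonresidues:
  assumes p: "prime p" "odd p" and e: "e1 + e2 + e3 = 0"
    and m: "\<not> p dvd e1 * e2 * e3 * m"
    and L: "Legendre d1 p = 1" "Legendre d2 p = -1" "Legendre d3 p = -1"
  shows "padic_solvable p 4 (D_eqs e1 e2 e3 m (d1,d2,d3))"
proof -
  have nd: "\<not> p dvd e1 * m" "\<not> p dvd e2 * m" "\<not> p dvd e3 * m"
    using m p(1) by (auto simp: prime_dvd_mult_iff)
  have e3: "- e2 * m - e1 * m = e3 * m"
  proof -
    have "- e2 * m - e1 * m - e3 * m = - (e1 + e2 + e3) * m" by (simp add: algebra_simps)
    thus ?thesis unfolding e by simp
  qed
  obtain x where x: "Legendre (x - (- e2 * m)) p \<noteq> -1" "Legendre (x - e1 * m) p \<noteq> 1" "Legendre (x - 0) p \<noteq> 1"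
    using exists_Legendre_pattern[OF p L(2), of "- e2 * m" "e1 * m" 0] nd unfolding e3 by auto
  define Q where "Q y \<longleftrightarrow> Legendre (d1 * (y + e2 * m)) p \<noteq> -1 \<and> Legendre (d2 * (y - e1 * m)) p \<noteq> -1 \<and> Legendre (d3 * y) p \<noteq> -1" for y
  have Qx: "Q x" using x by (auto simp: Q_def Legendre_mult[OF p] L)
  have Qc: "Q y" if "p dvd x - y" for y
  proof -
    have "[x = y] (mod p)" using that by (simp add: cong_iff_dvd_diff)
    hence "Legendre (d1 * (x + e2 * m)) p = Legendre (d1 * (y + e2 * m)) p"
      "Legendre (d2 * (x - e1 * m)) p = Legendre (d2 * (y - e1 * m)) p"
      "Legendre (d3 * x) p = Legendre (d3 * y) p"
      by (auto intro!: Legendre_cong cong_mult cong_add cong_diff)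
    thus ?thesis using Qx by (simp add: Q_def)
  qed
  have nd': "\<not> p dvd d1" "\<not> p dvd d2" "\<not> p dvd d3" using L by (auto simp flip: Legendre_eq_0_iff)
  have *: "Legendre (d * z) p = 1" if "Legendre (d * z) p \<noteq> -1" "\<not> p dvd d" "\<not> p dvd z" for d z
    using that Legendre_cases[of "d * z" p] p(1) by (auto simp: Legendre_eq_0_iff prime_dvd_mult_iff)
  \<comment> \<open>The roots -e2 m, e1 m and 0 are distinct modulo p, so x meets at most one of
    them. It is then moved onto that root exactly: the corresponding u_i becomes 0, and the other
    two conditions persist modulo p.\<close>
  have "\<exists>y. Q y \<and> (y = - e2 * m \<or> \<not> p dvd y + e2 * m) \<and> (y = e1 * m \<or> \<not> p dvd y - e1 * m) \<and> (y = 0 \<or> \<not> p dvd y)"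
  proof -
    consider "p dvd x - (- e2 * m)" | "p dvd x - e1 * m" | "p dvd x - 0"
      | "\<not> p dvd x - (- e2 * m)" "\<not> p dvd x - e1 * m" "\<not> p dvd x - 0" by blast
    thus ?thesis
    proof cases
      case 1
      thus ?thesis using Qc[OF 1] nd e3 by (intro exI[of _ "- e2 * m"]) simp
    next
      case 2
      have "e1 * m + e2 * m = - (e3 * m)" using e3 by simp
      thus ?thesis using Qc[OF 2] nd by (intro exI[of _ "e1 * m"]) simp
    next
      case 3
      thus ?thesis using Qc[OF 3] nd by (intro exI[of _ 0]) simp
    next
      case 4
      thus ?thesis using Qx by (intro exI[of _ x]) simp
    qed
  qed
  then obtain y where y: "Q y" "y = - e2 * m \<or> \<not> p dvd y + e2 * m" "y = e1 * m \<or> \<not> p dvd y - e1 * m" "y = 0 \<or> \<not> p dvd y"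
    by blast
  show ?thesis
    using y nd' * by (intro padic_solvable_D_affine[OF p e, of y]) (auto simp: Q_def)
qed

text \<open>The three symbols multiply to 1, so either all are +1, which gives a point with t = 0,
  or exactly one is +1, and a rotation brings it to the first place.\<close>

lemma padic_solvable_D_unramified:
  assumes p: "prime p" "odd p" and e: "e1 + e2 + e3 = 0"
    and m: "\<not> p dvd e1 * e2 * e3 * m" and d: "\<not> p dvd d1" "\<not> p dvd d2" "\<not> p dvd d3"
    and s: "d1 * d2 * d3 = s^2"
  shows "padic_solvable p 4 (D_eqs e1 e2 e3 m (d1,d2,d3))"
proof -
  have "\<not> p dvd d1 * d2 * d3" using d p(1) by (simp add: prime_dvd_mult_iff)
  hence "\<not> p dvd s" unfolding s by (auto simp: power2_eq_square)
  hence "Legendre (d1 * d2 * d3) p = 1" unfolding s using p(1) by (rule Legendre_square[rotated])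
  hence L: "Legendre d1 p * Legendre d2 p * Legendre d3 p = 1" by (simp add: Legendre_mult[OF p])
  have m': "\<not> p dvd e2 * e3 * e1 * m" "\<not> p dvd e3 * e1 * e2 * m" using m by (simp_all add: mult_ac)
  have e': "e2 + e3 + e1 = 0" "e3 + e1 + e2 = 0" using e by simp_all
  consider "Legendre d1 p = 1" "Legendre d2 p = 1" "Legendre d3 p = 1"
    | "Legendre d1 p = 1" "Legendre d2 p = -1" "Legendre d3 p = -1"
    | "Legendre d1 p = -1" "Legendre d2 p = 1" "Legendre d3 p = -1"
    | "Legendre d1 p = -1" "Legendre d2 p = -1" "Legendre d3 p = 1"
    using L Legendre_cases[of d1 p] Legendre_cases[of d2 p] Legendre_cases[of d3 p]
    by (elim disjE) simp_all
  thus ?thesis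
  proof cases
    case 1
    thus ?thesis using d p by (intro padic_solvable_D_squares square_mod_prime_power) auto
  next
    case 2
    thus ?thesis using padic_solvable_D_nonresidues p e m by blast
  next
    case 3
    have "padic_solvable p 4 (D_eqs e2 e3 e1 m (d2,d3,d1))"
      using padic_solvable_D_nonresidues[OF p e'(1) m'(1) 3(2) 3(3) 3(1)] .
    thus ?thesis by (simp add: padic_solvable_D_rotate)
  next
    case 4
    have "padic_solvable p 4 (D_eqs e3 e1 e2 m (d3,d1,d2))"
      using padic_solvable_D_nonresidues[OF p e'(2) m'(2) 4(3) 4(1) 4(2)] .
    thus ?thesis by (metis padic_solvable_D_rotate)
  qed
qed

section \<open>Solvability at ramified primes and Hilbert symbols\<close>

lemma multiplicity_squarefree:
  fixes p d :: int
  assumes "prime p" "squarefree d"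
  shows "multiplicity p d = (if p dvd d then 1 else 0)"
proof (cases "p dvd d")
  case True
  have d0: "d \<noteq> 0" using assms(2) by auto
  hence "multiplicity p d \<le> 1"
    using assms squarefree_factorial_semiring'' by blast
  moreover have "multiplicity p d > 0"
    using True prime_imp_prime_elem[OF assms(1)] d0 by (simp add: prime_multiplicity_gt_zero_iff)
  ultimately show ?thesis using True by simp
qed (simp add: not_dvd_imp_multiplicity_0)

text \<open>The valuations of the d_i are 0 or 1 and have even sum: p divides none of them or
  exactly two. This parity drives every later case distinction at p.\<close>

lemma prime_dvd_square_triple:
  fixes p d1 d2 d3 :: int
  assumes p: "prime p" and sf: "squarefree d1" "squarefree d2" "squarefree d3" and s: "d1 * d2 * d3 = s^2"
  shows "p dvd d3 \<longleftrightarrow> (p dvd d1) \<noteq> (p dvd d2)"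
proof -
  have nz: "d1 \<noteq> 0" "d2 \<noteq> 0" "d3 \<noteq> 0" using sf by auto
  have "multiplicity p (d1 * d2 * d3) = multiplicity p d1 + multiplicity p d2 + multiplicity p d3"
    using nz prime_imp_prime_elem[OF p] by (simp add: prime_elem_multiplicity_mult_distrib)
  moreover have "multiplicity p (s^2) = 2 * multiplicity p s"
    using p nz s by (intro prime_elem_multiplicity_power_distrib) auto
  ultimately have "multiplicity p d1 + multiplicity p d2 + multiplicity p d3 = 2 * multiplicity p s"
    using s by simp
  hence "even (multiplicity p d1 + multiplicity p d2 + multiplicity p d3)" by simp
  thus ?thesis using p sf by (auto simp: multiplicity_squarefree split: if_splits)
qed

lemma not_dvd_div_squarefree:
  fixes p d :: int
  assumes "prime p" "squarefree d" "p dvd d"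
  shows "\<not> p dvd d div p"
proof
  assume "p dvd d div p"
  hence "p * p dvd d" using assms(3) by (metis dvd_div_iff_mult dvd_0_left_iff mult_eq_0_iff not_prime_0 assms(1))
  hence "p dvd 1" using squarefreeD[OF assms(2), of p] by (simp add: power2_eq_square)
  thus False using assms(1) not_prime_unit by blast
qed

text \<open>Adding the first two equations modulo p leaves -e3 m t^2, so p divides t, and then u3.
  The equations modulo p^2 now force p to divide u1 and u2 as well, against primitivity.\<close>

lemma not_padic_solvable_D_two_ramified:
  assumes p: "prime p" and e: "e1 + e2 + e3 = 0" and e3: "\<not> p dvd e3 * m"
    and d: "\<not> p dvd d1" "\<not> p dvd d2" "\<not> p dvd d3"
  shows "\<not> padic_solvable p 4 (D_eqs e1 e2 e3 m (p * d1,p * d2,d3))"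
proof
  assume "padic_solvable p 4 (D_eqs e1 e2 e3 m (p * d1,p * d2,d3))"
  then obtain t u1 u2 u3 where pr: "\<not> p dvd t \<or> \<not> p dvd u1 \<or> \<not> p dvd u2 \<or> \<not> p dvd u3" and
      eq: "p^2 dvd e1*m*t^2 + (p*d2)*u2^2 - d3*u3^2"
          "p^2 dvd e2*m*t^2 + d3*u3^2 - (p*d1)*u1^2"
    unfolding padic_solvable_D_iff by blast
  have pp: "p dvd x" if "p^2 dvd x" for x using that by (metis dvd_mult_left power2_eq_square)
  have "p dvd (e1*m*t^2 + (p*d2)*u2^2 - d3*u3^2) + (e2*m*t^2 + d3*u3^2 - (p*d1)*u1^2) - p * (d2*u2^2 - d1*u1^2)"
    by (intro dvd_diff[OF dvd_add[OF pp[OF eq(1)] pp[OF eq(2)]]]) simp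
  also have "\<dots> = (e1 + e2) * m * t^2" by (simp add: algebra_simps)
  also have "e1 + e2 = - e3" using e by simp
  finally have t: "p dvd t" using p e3 by (auto simp: prime_dvd_mult_iff prime_dvd_power_iff)
  hence "p dvd e1*m*t^2 + (p*d2)*u2^2" by (simp add: power2_eq_square)
  hence "p dvd d3*u3^2" using pp[OF eq(1)] by (metis dvd_diff_right_iff)
  hence u3: "p dvd u3" using p d by (auto simp: prime_dvd_mult_iff prime_dvd_power_iff)
  have "p^2 dvd t^2" "p^2 dvd u3^2" using t u3 by auto
  hence "p^2 dvd e1*m*t^2" "p^2 dvd e2*m*t^2" "p^2 dvd d3*u3^2" by auto
  \<comment> \<open>After cancellation the two expressions are p d2 u2^2 and p d1 u1^2.\<close>
  hence "p^2 dvd e1*m*t^2 + (p*d2)*u2^2 - d3*u3^2 - e1*m*t^2 + d3*u3^2"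
    "p^2 dvd e2*m*t^2 + d3*u3^2 - e2*m*t^2 - d3*u3^2 - (e2*m*t^2 + d3*u3^2 - (p*d1)*u1^2) + e2*m*t^2 + d3*u3^2"
    using eq by (simp_all only: dvd_add dvd_diff)
  hence "p * p dvd p * (d2*u2^2)" "p * p dvd p * (d1*u1^2)"
    by (simp_all add: power2_eq_square algebra_simps)
  hence "p dvd u2" "p dvd u1"
    using p d by (auto simp: prime_dvd_mult_iff prime_dvd_power_iff)
  with pr t u3 show False by blast
qed

text \<open>If p divided some d_i, it would divide exactly two of them; a rotation carries this pair
  to the first two places, where the obstruction modulo p^2 applies.\<close>

lemma padic_solvable_D_imp_unramified:
  assumes p: "prime p" and e: "e1 + e2 + e3 = 0" and m: "\<not> p dvd e1 * e2 * e3 * m"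
    and sf: "squarefree d1" "squarefree d2" "squarefree d3" and s: "d1 * d2 * d3 = s^2"
    and D: "padic_solvable p 4 (D_eqs e1 e2 e3 m (d1,d2,d3))"
  shows "\<not> p dvd d1 \<and> \<not> p dvd d2 \<and> \<not> p dvd d3"
proof (rule ccontr)
  assume ram: "\<not> (\<not> p dvd d1 \<and> \<not> p dvd d2 \<and> \<not> p dvd d3)"
  have nm: "\<not> p dvd e1 * m" "\<not> p dvd e2 * m" "\<not> p dvd e3 * m"
    using m p by (auto simp: prime_dvd_mult_iff)
  have e': "e2 + e3 + e1 = 0" "e3 + e1 + e2 = 0" using e by simp_all
  note pat = prime_dvd_square_triple[OF p sf s]
  note dv = not_dvd_div_squarefree[OF p]
  note no = not_padic_solvable_D_two_ramified[OF p]
  have D': "padic_solvable p 4 (D_eqs e2 e3 e1 m (d2,d3,d1))" "padic_solvable p 4 (D_eqs e3 e1 e2 m (d3,d1,d2))"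
    using D padic_solvable_D_rotate by metis+
  consider "p dvd d1" "p dvd d2" "\<not> p dvd d3" | "p dvd d2" "p dvd d3" "\<not> p dvd d1" | "p dvd d3" "p dvd d1" "\<not> p dvd d2"
    using ram pat by blast
  thus False
  proof cases
    case 1
    show False using no[OF e nm(3) dv[OF sf(1) 1(1)] dv[OF sf(2) 1(2)] 1(3)] D 1 by simp
  next
    case 2
    show False using no[OF e'(1) nm(1) dv[OF sf(2) 2(1)] dv[OF sf(3) 2(2)] 2(3)] D' 2 by simp
  next
    case 3
    show False using no[OF e'(2) nm(2) dv[OF sf(3) 3(1)] dv[OF sf(1) 3(2)] 3(3)] D' 3 by simp
  qed
qed

section \<open>Local conditions at the primes dividing n\<close>

lemma Legendre_eq_1I:
  fixes p :: int
  assumes p: "prime p" "odd p" and d: "p dvd a * x^2 - b * y^2" and x: "\<not> p dvd x" and ab: "\<not> p dvd a" "\<not> p dvd b"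
  shows "Legendre (a * b) p = 1"
proof -
  have c: "[a * x^2 = b * y^2] (mod p)" using d by (simp add: cong_iff_dvd_diff)
  have "\<not> p dvd a * x^2" using p x ab by (simp add: prime_dvd_mult_iff prime_dvd_power_iff)
  hence "\<not> p dvd b * y^2" using cong_dvd_iff[OF c] by simp
  hence y: "\<not> p dvd y" by (auto simp: power2_eq_square)
  have "Legendre (a * x^2) p = Legendre (b * y^2) p" using c by (rule Legendre_cong)
  hence "Legendre a p = Legendre b p" using x y p by (simp add: Legendre_mult Legendre_square)
  thus ?thesis using Legendre_cases[of a p] ab p by (auto simp: Legendre_mult Legendre_eq_0_iff)
qed

text \<open>For \<open>p\<close> exactly dividing \<open>n\<close>, this is the Hilbert symbol \<open>(d, -n)\<^sub>p\<close>: it is \<open>1\<close> iff \<open>d\<close> or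
  \<open>d n\<close> is a square in \<open>\<rat>\<^sub>p\<close>.\<close>

definition norm_symbol :: "int \<Rightarrow> int \<Rightarrow> int \<Rightarrow> int" where
  "norm_symbol n p d = Legendre (if p dvd d then (n div p) * (d div p) else d) p"

lemma Legendre_square_triple:
  fixes p :: int
  assumes p: "prime p" "odd p" and d: "\<not> p dvd d1" "\<not> p dvd d2" "\<not> p dvd d3" and s: "d1 * d2 * d3 = s^2"
  shows "Legendre d1 p * Legendre d2 p * Legendre d3 p = 1"
proof -
  have "\<not> p dvd s^2" using d p unfolding s[symmetric] by (simp add: prime_dvd_mult_iff)
  hence "\<not> p dvd s" by (auto simp: power2_eq_square)
  hence "Legendre (d1 * d2 * d3) p = 1" unfolding s by (intro Legendre_square p)
  thus ?thesis using p by (simp add: Legendre_mult)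
qed

text \<open>This is the Hilbert symbol of a square. If p divides two of the entries, p^2 can be
  taken out of the square, and the factor n/p occurs twice and cancels. Hence two trivial symbols
  imply that the third is trivial.\<close>

lemma norm_symbol_square_triple:
  fixes p n :: int
  assumes p: "prime p" "odd p" and n: "squarefree n" "p dvd n"
    and sf: "squarefree d1" "squarefree d2" "squarefree d3" and s: "d1 * d2 * d3 = s^2"
  shows "norm_symbol n p d1 * norm_symbol n p d2 * norm_symbol n p d3 = 1"
proof -
  have *: "norm_symbol n p a * norm_symbol n p b * norm_symbol n p c = 1"
    if sf: "squarefree a" "squarefree b" "squarefree c" and s: "a * b * c = s^2"
       and d: "p dvd a" "p dvd b" "\<not> p dvd c" for a b c
  proof -
    have n': "\<not> p dvd n div p" using n p not_dvd_div_squarefree by blast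
    have "p dvd s^2" using d unfolding s[symmetric] by auto
    hence "p dvd s" using p by (simp add: prime_dvd_power_iff)
    then obtain s' where s': "s = p * s'" by (auto simp: dvd_def)
    have p0: "p \<noteq> 0" using p by auto
    have "(p * (a div p)) * (p * (b div p)) * c = (p * s')^2" using s s' d by simp
    hence "p^2 * ((a div p) * (b div p) * c) = p^2 * s'^2" by (simp add: power2_eq_square mult_ac)
    hence "(a div p) * (b div p) * c = s'^2" using p0 by simp
    hence "Legendre (a div p) p * Legendre (b div p) p * Legendre c p = 1"
      using not_dvd_div_squarefree p sf d by (intro Legendre_square_triple) auto
    moreover have "Legendre (n div p) p * Legendre (n div p) p = 1"
      using n' Legendre_cases[of "n div p" p] by (auto simp: Legendre_eq_0_iff)
    ultimately show ?thesis using d p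
      by (simp add: norm_symbol_def Legendre_mult mult_ac)
  qed
  note pat = prime_dvd_square_triple[OF p(1) sf s]
  consider "\<not> p dvd d1" "\<not> p dvd d2" "\<not> p dvd d3" | "p dvd d1" "p dvd d2" "\<not> p dvd d3"
    | "p dvd d2" "p dvd d3" "\<not> p dvd d1" | "p dvd d3" "p dvd d1" "\<not> p dvd d2"
    using pat by blast
  thus ?thesis
  proof cases
    case 1
    thus ?thesis using Legendre_square_triple[OF p 1 s] by (simp add: norm_symbol_def)
  next
    case 2
    thus ?thesis using *[OF sf s] by blast
  next
    case 3
    thus ?thesis using *[OF sf(2,3,1)] s by (simp add: mult_ac)
  next
    case 4
    thus ?thesis using *[OF sf(3,1,2)] s by (simp add: mult_ac)
  qed
qed

text \<open>Since p | n, the equations modulo p say that all d_i u_i^2 agree. If p divided every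
  u_i, the first equation modulo p^2 would give p | t; so the u_i are units and the products d_i d_j
  are residues. As d1 d2 d3 is a unit square, each d_i is a residue.\<close>

lemma padic_solvable_D_unit_iff:
  fixes p n :: int
  assumes p: "prime p" "odd p" and n: "squarefree n" "p dvd n"
    and e: "\<not> p dvd e1"
    and d: "\<not> p dvd d1" "\<not> p dvd d2" "\<not> p dvd d3" and s: "d1 * d2 * d3 = s^2"
  shows "padic_solvable p 4 (D_eqs e1 e2 e3 n (d1,d2,d3)) \<longleftrightarrow>
     Legendre d1 p = 1 \<and> Legendre d2 p = 1 \<and> Legendre d3 p = 1"
proof
  assume "Legendre d1 p = 1 \<and> Legendre d2 p = 1 \<and> Legendre d3 p = 1"
  thus "padic_solvable p 4 (D_eqs e1 e2 e3 n (d1,d2,d3))"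
    using d p by (intro padic_solvable_D_squares square_mod_prime_power) auto
next
  assume "padic_solvable p 4 (D_eqs e1 e2 e3 n (d1,d2,d3))"
  then obtain t u1 u2 u3 where pr: "\<not> p dvd t \<or> \<not> p dvd u1 \<or> \<not> p dvd u2 \<or> \<not> p dvd u3" and
      eq: "p^2 dvd e1*n*t^2 + d2*u2^2 - d3*u3^2"
          "p^2 dvd e2*n*t^2 + d3*u3^2 - d1*u1^2"
          "p^2 dvd e3*n*t^2 + d1*u1^2 - d2*u2^2"
    unfolding padic_solvable_D_iff by blast
  have pp: "p dvd x - y" if "p^2 dvd c*n*t^2 + x - y" for c x y
  proof -
    have "p dvd c*n*t^2 + x - y" using that by (metis dvd_mult_left power2_eq_square)
    moreover have "p dvd c*n*t^2" using n by simp
    ultimately have "p dvd (c*n*t^2 + x - y) - c*n*t^2" by (rule dvd_diff)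
    thus ?thesis by (simp add: algebra_simps)
  qed
  have eq': "p dvd d2*u2^2 - d3*u3^2" "p dvd d3*u3^2 - d1*u1^2" "p dvd d1*u1^2 - d2*u2^2"
    using eq pp by blast+
  have tr: "p dvd x \<longrightarrow> p dvd y" if "p dvd a * x^2 - b * y^2" "\<not> p dvd b" for a b x y
  proof
    assume "p dvd x"
    hence "p dvd a * x^2" by (auto simp: power2_eq_square)
    hence "p dvd b * y^2" using that by (metis dvd_diff_right_iff)
    thus "p dvd y" using that p by (auto simp: prime_dvd_mult_iff prime_dvd_power_iff)
  qed
  have u: "\<not> p dvd u1" "\<not> p dvd u2" "\<not> p dvd u3"
  proof -
    have "\<not> (p dvd u1 \<and> p dvd u2 \<and> p dvd u3)"
    proof
      assume a: "p dvd u1 \<and> p dvd u2 \<and> p dvd u3"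
      hence "p^2 dvd d2*u2^2" "p^2 dvd d3*u3^2" by auto
      hence "p^2 dvd (e1*n*t^2 + d2*u2^2 - d3*u3^2) - d2*u2^2 + d3*u3^2"
        using eq(1) by (simp only: dvd_add dvd_diff)
      also have "\<dots> = p * ((n div p) * e1 * t^2)" using n by (simp add: mult_ac)
      finally have "p dvd (n div p) * e1 * t^2"
        unfolding power2_eq_square[of p] using p by auto
      hence "p dvd t" using not_dvd_div_squarefree[OF p(1) n] p e
        by (simp add: prime_dvd_mult_iff prime_dvd_power_iff)
      with pr a show False by blast
    qed
    thus "\<not> p dvd u1" "\<not> p dvd u2" "\<not> p dvd u3" using tr eq' d by blast+
  qed
  have "Legendre (d2 * d3) p = 1" "Legendre (d3 * d1) p = 1" "Legendre (d1 * d2) p = 1"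
    using Legendre_eq_1I[OF p] eq' u d by blast+
  thus "Legendre d1 p = 1 \<and> Legendre d2 p = 1 \<and> Legendre d3 p = 1"
    using Legendre_square_triple[OF p d s] p by (simp add: Legendre_mult mult_ac) 
qed

text \<open>The witness has t = 1 and u2 = 0: it lies above the 2-torsion point whose abscissa is e1
  times the twisting factor, so only d1 u1^2 = -e3 n and d3 u3^2 = e1 n remain to be solved.
  Conversely p | u2 for every primitive solution, and dividing by p yields these equations modulo p
  up to the unit t^2.\<close>

lemma padic_solvable_D_ramified_iff:
  fixes p n :: int
  assumes p: "prime p" "odd p" "Legendre (-1) p = 1" and n: "\<not> p dvd n"
    and e: "e1 + e2 + e3 = 0" "Legendre e1 p = 1" "Legendre e3 p = 1"
    and d: "\<not> p dvd d1" "\<not> p dvd d2" "\<not> p dvd d3"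
  shows "padic_solvable p 4 (D_eqs e1 e2 e3 (p * n) (p * d1,d2,p * d3)) \<longleftrightarrow>
     Legendre (n * d1) p = 1 \<and> Legendre (n * d3) p = 1"
proof
  assume L: "Legendre (n * d1) p = 1 \<and> Legendre (n * d3) p = 1"
  show "padic_solvable p 4 (D_eqs e1 e2 e3 (p * n) (p * d1,d2,p * d3))"
    unfolding padic_solvable_D_iff
  proof
    fix k
    have "d1 * (- (e3 * n)) = (-1) * e3 * (n * d1)" "d3 * (e1 * n) = e1 * (n * d3)" by simp_all
    hence "Legendre (d1 * (- (e3 * n))) p = 1" "Legendre (d3 * (e1 * n)) p = 1"
      using L e p by (simp_all only: Legendre_mult[OF p(1,2)])
    then obtain u1 u3 where u1: "p^k dvd d1 * u1^2 - (- (e3 * n))" and u3: "p^k dvd d3 * u3^2 - e1 * n"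
      using scaled_square_mod_prime_power[OF p(1,2)] by meson
    have "p^k dvd (-p) * (d3 * u3^2 - e1 * n)" using u3 by (rule dvd_mult)
    also have "\<dots> = e1*(p*n)*1^2 + d2*0^2 - (p*d3)*u3^2" by (simp add: algebra_simps)
    finally have 1: "p^k dvd e1*(p*n)*1^2 + d2*0^2 - (p*d3)*u3^2" .
    have "p^k dvd p * (d1 * u1^2 - (- (e3 * n)))" using u1 by (rule dvd_mult)
    also have "\<dots> = e3*(p*n)*1^2 + (p*d1)*u1^2 - d2*0^2" by (simp add: algebra_simps)
    finally have 3: "p^k dvd e3*(p*n)*1^2 + (p*d1)*u1^2 - d2*0^2" .
    have "e2*(p*n)*1^2 + (p*d3)*u3^2 - (p*d1)*u1^2
       = - (e1*(p*n)*1^2 + d2*0^2 - (p*d3)*u3^2) - (e3*(p*n)*1^2 + (p*d1)*u1^2 - d2*0^2) + (e1 + e2 + e3) * (p*n)"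
      by (simp add: algebra_simps)
    also have "p^k dvd \<dots>" unfolding e(1) using 1 3 by (simp only: mult_zero_left add_0_right dvd_diff dvd_minus_iff)
    finally have 2: "p^k dvd e2*(p*n)*1^2 + (p*d3)*u3^2 - (p*d1)*u1^2" .
    have "\<not> p dvd 1" using p(1) not_prime_unit by blast
    with 1 2 3 show "\<exists>t u1 u2 u3. (\<not> p dvd t \<or> \<not> p dvd u1 \<or> \<not> p dvd u2 \<or> \<not> p dvd u3) \<and>
        p^k dvd e1*(p*n)*t^2 + d2*u2^2 - (p*d3)*u3^2 \<and>
        p^k dvd e2*(p*n)*t^2 + (p*d3)*u3^2 - (p*d1)*u1^2 \<and>
        p^k dvd e3*(p*n)*t^2 + (p*d1)*u1^2 - d2*u2^2" by blast
  qed
next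
  assume "padic_solvable p 4 (D_eqs e1 e2 e3 (p * n) (p * d1,d2,p * d3))"
  then obtain t u1 u2 u3 where pr: "\<not> p dvd t \<or> \<not> p dvd u1 \<or> \<not> p dvd u2 \<or> \<not> p dvd u3" and
      eq: "p^2 dvd e1*(p*n)*t^2 + d2*u2^2 - (p*d3)*u3^2"
          "p^2 dvd e3*(p*n)*t^2 + (p*d1)*u1^2 - d2*u2^2"
    unfolding padic_solvable_D_iff by blast
  have e': "\<not> p dvd e1" "\<not> p dvd e3" using e by (auto simp: Legendre_eq_1_iff)
  have "p dvd e1*(p*n)*t^2 + d2*u2^2 - (p*d3)*u3^2" using eq(1) by (metis dvd_mult_left power2_eq_square)
  hence "p dvd e1*(p*n)*t^2 + d2*u2^2 - (p*d3)*u3^2 - p * (e1 * n * t^2 - d3 * u3^2)"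
    by (rule dvd_diff) simp
  hence "p dvd d2 * u2^2" by (simp add: algebra_simps)
  hence u2: "p dvd u2" using p d by (auto simp: prime_dvd_mult_iff prime_dvd_power_iff)
  hence "p^2 dvd d2 * u2^2" by simp
  hence "p^2 dvd e1*(p*n)*t^2 + d2*u2^2 - (p*d3)*u3^2 - d2 * u2^2"
     "p^2 dvd e3*(p*n)*t^2 + (p*d1)*u1^2 - d2*u2^2 + d2 * u2^2"
    using eq by (simp_all only: dvd_add dvd_diff)
  hence "p * p dvd p * (e1*n*t^2 - d3*u3^2)" "p * p dvd p * ((- e3*n)*t^2 - d1*u1^2) * (-1)"
    by (simp_all add: algebra_simps power2_eq_square)
  hence eq': "p dvd (e1*n)*t^2 - d3*u3^2" "p dvd (- e3*n)*t^2 - d1*u1^2" using p by auto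
  have t: "\<not> p dvd t"
  proof
    assume t: "p dvd t"
    hence "p dvd (e1*n)*t^2" "p dvd (-e3*n)*t^2" by (auto simp: power2_eq_square)
    hence "p dvd d3*u3^2" "p dvd d1*u1^2" using eq' by (metis dvd_diff_right_iff)+
    hence "p dvd u3" "p dvd u1" using p d by (auto simp: prime_dvd_mult_iff prime_dvd_power_iff)
    with t u2 pr show False by blast
  qed
  have "Legendre (e1 * n * d3) p = 1" "Legendre (- e3 * n * d1) p = 1"
    using Legendre_eq_1I[OF p(1,2) eq'(1) t _ d(3)] Legendre_eq_1I[OF p(1,2) eq'(2) t _ d(1)] p e' n
    by (auto simp: prime_dvd_mult_iff)
  moreover have "e1 * n * d3 = e1 * (n * d3)" "- e3 * n * d1 = (-1) * e3 * (n * d1)" by simp_all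
  ultimately have "Legendre (e1 * (n * d3)) p = 1" "Legendre ((-1) * e3 * (n * d1)) p = 1" by (simp_all only:)
  thus "Legendre (n * d1) p = 1 \<and> Legendre (n * d3) p = 1"
    unfolding Legendre_mult[OF p(1,2)] e p(3) by simp
qed

text \<open>Each ramification pattern gives conditions on two of the entries, depending on the
  pattern. Since the three norm symbols multiply to 1, they can always be exchanged for the
  conditions on d1 and d2.\<close>

lemma padic_solvable_D_norm_symbol:
  fixes p n :: int
  assumes p: "prime p" "odd p" "Legendre (-1) p = 1" and n: "squarefree n" "p dvd n"
    and e: "e1 + e2 + e3 = 0" "Legendre e1 p = 1" "Legendre e2 p = 1" "Legendre e3 p = 1"
    and sf: "squarefree d1" "squarefree d2" "squarefree d3" and s: "d1 * d2 * d3 = s^2"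
  shows "padic_solvable p 4 (D_eqs e1 e2 e3 n (d1,d2,d3)) \<longleftrightarrow> norm_symbol n p d1 = 1 \<and> norm_symbol n p d2 = 1"
proof -
  have n': "\<not> p dvd n div p" and pn: "p * (n div p) = n" using not_dvd_div_squarefree p n by auto
  have e': "e2 + e3 + e1 = 0" "e3 + e1 + e2 = 0" using e by simp_all
  note pat = prime_dvd_square_triple[OF p(1) sf s]
  note dv = not_dvd_div_squarefree[OF p(1)]
  note S = norm_symbol_square_triple[OF p(1,2) n sf s]
  consider "\<not> p dvd d1" "\<not> p dvd d2" "\<not> p dvd d3" | "p dvd d1" "p dvd d2" "\<not> p dvd d3"
    | "p dvd d2" "p dvd d3" "\<not> p dvd d1" | "p dvd d3" "p dvd d1" "\<not> p dvd d2"
    using pat by blast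
  thus ?thesis
  proof cases
    case 1
    hence N: "norm_symbol n p d1 = Legendre d1 p" "norm_symbol n p d2 = Legendre d2 p" "norm_symbol n p d3 = Legendre d3 p"
      by (simp_all add: norm_symbol_def)
    have "\<not> p dvd e1" using e(2) by (simp add: Legendre_eq_1_iff)
    from padic_solvable_D_unit_iff[OF p(1,2) n this 1 s] show ?thesis using S unfolding N by auto
  next
    case 2
    have "padic_solvable p 4 (D_eqs e2 e3 e1 n (d2,d3,d1)) \<longleftrightarrow> norm_symbol n p d2 = 1 \<and> norm_symbol n p d1 = 1"
      using padic_solvable_D_ramified_iff[OF p n' e'(1) e(3) e(2) dv[OF sf(2) 2(2)] 2(3) dv[OF sf(1) 2(1)]] 2 pn
      by (simp add: norm_symbol_def)
    thus ?thesis using padic_solvable_D_rotate by blast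
  next
    case 3
    have "padic_solvable p 4 (D_eqs e3 e1 e2 n (d3,d1,d2)) \<longleftrightarrow> norm_symbol n p d3 = 1 \<and> norm_symbol n p d2 = 1"
      using padic_solvable_D_ramified_iff[OF p n' e'(2) e(4) e(3) dv[OF sf(3) 3(2)] 3(3) dv[OF sf(2) 3(1)]] 3 pn
      by (simp add: norm_symbol_def)
    thus ?thesis using S by (auto simp: padic_solvable_D_rotate[of p e1 e2 e3] padic_solvable_D_rotate[of p e3 e1 e2])
  next
    case 4
    have "padic_solvable p 4 (D_eqs e1 e2 e3 n (d1,d2,d3)) \<longleftrightarrow> norm_symbol n p d1 = 1 \<and> norm_symbol n p d3 = 1"
      using padic_solvable_D_ramified_iff[OF p n' e(1) e(2) e(4) dv[OF sf(1) 4(2)] 4(3) dv[OF sf(3) 4(1)]] 4 pn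
      by (simp add: norm_symbol_def)
    thus ?thesis using S by auto
  qed
qed

section \<open>Hilbert symbols as solvability of conics\<close>

lemma padic_solvable_conic_iff:
  "padic_solvable p 3 [\<lambda>x. a * (x 0)^2 + b * (x 1)^2 - (x 2)^2] \<longleftrightarrow>
     (\<forall>k. \<exists>x y z. (\<not> p dvd x \<or> \<not> p dvd y \<or> \<not> p dvd z) \<and> p^k dvd a * x^2 + b * y^2 - z^2)"
proof -
  have ex: "(\<exists>i<3. P i) \<longleftrightarrow> P 0 \<or> P 1 \<or> P (2::nat)" for P
    by (auto simp: numeral_eq_Suc less_Suc_eq)
  have "(\<exists>x::nat \<Rightarrow> int. (\<exists>i<3. \<not> p dvd x i) \<and> (\<forall>F\<in>set [\<lambda>x. a * (x 0)^2 + b * (x 1)^2 - (x 2)^2]. p ^ k dvd F x)) \<longleftrightarrow>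
    (\<exists>x y z. (\<not> p dvd x \<or> \<not> p dvd y \<or> \<not> p dvd z) \<and> p^k dvd a * x^2 + b * y^2 - z^2)" (is "?l \<longleftrightarrow> ?r") for k
  proof
    assume ?l
    then obtain x :: "nat \<Rightarrow> int" where "\<exists>i<3. \<not> p dvd x i" "p^k dvd a * (x 0)^2 + b * (x 1)^2 - (x 2)^2" by auto
    thus ?r by (intro exI[of _ "x 0"] exI[of _ "x 1"] exI[of _ "x 2"]) (simp add: ex)
  next
    assume ?r
    then obtain x y z where "\<not> p dvd x \<or> \<not> p dvd y \<or> \<not> p dvd z" "p^k dvd a * x^2 + b * y^2 - z^2" by blast
    thus ?l by (intro exI[of _ "(!) [x, y, z]"]) (simp add: ex)
  qed
  thus ?thesis unfolding padic_solvable_def by (intro all_cong1)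
qed

text \<open>Modulo p the conic becomes a x^2 = z^2. If p divided x, it would divide z, and then y by
  the equation modulo p^2; so x is a unit and a is a residue. A square root s of a gives the point
  (1, 0, s).\<close>

lemma hilbert_add_unit:
  fixes p n :: int
  assumes p: "prime p" "odd p" and n: "\<not> p dvd n" and a: "\<not> p dvd a"
  shows "hilbert_add p a (- (p * n)) = (if Legendre a p = 1 then 0 else 1)"
proof -
  have "padic_solvable p 3 [\<lambda>x. a * (x 0)^2 + (- (p * n)) * (x 1)^2 - (x 2)^2] \<longleftrightarrow> Legendre a p = 1"
    unfolding padic_solvable_conic_iff
  proof
    assume L: "Legendre a p = 1"
    show "\<forall>k. \<exists>x y z. (\<not> p dvd x \<or> \<not> p dvd y \<or> \<not> p dvd z) \<and> p^k dvd a * x^2 + - (p * n) * y^2 - z^2"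
    proof
      fix k
      obtain s where "[s^2 = a] (mod p^k)" using square_mod_prime_power[OF p L] by blast
      hence "p^k dvd a * 1^2 + - (p * n) * 0^2 - s^2" by (simp add: cong_iff_dvd_diff dvd_diff_commute)
      moreover have "\<not> p dvd 1" using p(1) not_prime_unit by blast
      ultimately show "\<exists>x y z. (\<not> p dvd x \<or> \<not> p dvd y \<or> \<not> p dvd z) \<and> p^k dvd a * x^2 + - (p * n) * y^2 - z^2"
        by blast
    qed
  next
    assume "\<forall>k. \<exists>x y z. (\<not> p dvd x \<or> \<not> p dvd y \<or> \<not> p dvd z) \<and> p^k dvd a * x^2 + - (p * n) * y^2 - z^2"
    then obtain x y z where pr: "\<not> p dvd x \<or> \<not> p dvd y \<or> \<not> p dvd z"
      and eq: "p^2 dvd a * x^2 + - (p * n) * y^2 - z^2" by blast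
    have "p dvd a * x^2 + - (p * n) * y^2 - z^2 + p * (n * y^2)"
      using eq by (intro dvd_add) (metis dvd_mult_left power2_eq_square, simp)
    hence eq': "p dvd a * x^2 - 1 * z^2" by (simp add: algebra_simps)
    have x: "\<not> p dvd x"
    proof
      assume x: "p dvd x"
      hence "p dvd a * x^2" by (auto simp: power2_eq_square)
      hence "p dvd z^2" using eq' by (metis dvd_diff_right_iff mult_1)
      hence z: "p dvd z" using p by (simp add: prime_dvd_power_iff)
      hence "p^2 dvd z^2" "p^2 dvd a * x^2" using x by auto
      hence "p^2 dvd a * x^2 - z^2 - (a * x^2 + - (p * n) * y^2 - z^2)"
        using eq by (simp only: dvd_diff)
      hence "p * p dvd p * (n * y^2)" by (simp add: power2_eq_square algebra_simps)
      hence "p dvd y" using p n by (auto simp: prime_dvd_mult_iff prime_dvd_power_iff)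
      with x z pr show False by blast
    qed
    show "Legendre a p = 1" using Legendre_eq_1I[OF p eq' x a] p(1) not_prime_unit by auto
  qed
  thus ?thesis by (simp add: hilbert_add_def)
qed

text \<open>Since (p, -p)_p = 1, this symbol equals (p, n)_p. Concretely p | z, and dividing the
  conic by p leaves n y^2 = x^2 modulo p.\<close>

lemma hilbert_add_uniformizer:
  fixes p n :: int
  assumes p: "prime p" "odd p" and n: "\<not> p dvd n"
  shows "hilbert_add p p (- (p * n)) = (if Legendre n p = 1 then 0 else 1)"
proof -
  have "padic_solvable p 3 [\<lambda>x. p * (x 0)^2 + (- (p * n)) * (x 1)^2 - (x 2)^2] \<longleftrightarrow> Legendre n p = 1"
    unfolding padic_solvable_conic_iff
  proof
    assume L: "Legendre n p = 1"
    show "\<forall>k. \<exists>x y z. (\<not> p dvd x \<or> \<not> p dvd y \<or> \<not> p dvd z) \<and> p^k dvd p * x^2 + - (p * n) * y^2 - z^2"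
    proof
      fix k
      obtain s where "[s^2 = n] (mod p^k)" using square_mod_prime_power[OF p L] by blast
      hence "p^k dvd p * (s^2 - n)" by (simp add: cong_iff_dvd_diff)
      hence "p^k dvd p * s^2 + - (p * n) * 1^2 - 0^2" by (simp add: algebra_simps)
      moreover have "\<not> p dvd 1" using p(1) not_prime_unit by blast
      ultimately show "\<exists>x y z. (\<not> p dvd x \<or> \<not> p dvd y \<or> \<not> p dvd z) \<and> p^k dvd p * x^2 + - (p * n) * y^2 - z^2"
        by blast
    qed
  next
    assume "\<forall>k. \<exists>x y z. (\<not> p dvd x \<or> \<not> p dvd y \<or> \<not> p dvd z) \<and> p^k dvd p * x^2 + - (p * n) * y^2 - z^2"
    then obtain x y z where pr: "\<not> p dvd x \<or> \<not> p dvd y \<or> \<not> p dvd z"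
      and eq: "p^2 dvd p * x^2 + - (p * n) * y^2 - z^2" by blast
    have "p dvd p * (x^2 - n * y^2) - (p * x^2 + - (p * n) * y^2 - z^2)"
      by (rule dvd_diff) (simp, use eq in \<open>metis dvd_mult_left power2_eq_square\<close>)
    hence "p dvd z^2" by (simp add: algebra_simps)
    hence z: "p dvd z" using p by (simp add: prime_dvd_power_iff)
    hence "p^2 dvd z^2" by simp
    hence "p^2 dvd - (p * x^2 + - (p * n) * y^2 - z^2) - z^2" using eq by (simp only: dvd_diff dvd_minus_iff)
    hence "p * p dvd p * (n * y^2 - 1 * x^2)" by (simp add: algebra_simps power2_eq_square)
    hence eq': "p dvd n * y^2 - 1 * x^2" using p by auto
    have y: "\<not> p dvd y"
    proof
      assume y: "p dvd y"
      hence "p dvd n * y^2" by (auto simp: power2_eq_square)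
      hence "p dvd x^2" using eq' by (metis dvd_diff_right_iff mult_1)
      hence "p dvd x" using p by (simp add: prime_dvd_power_iff)
      with y z pr show False by blast
    qed
    show "Legendre n p = 1" using Legendre_eq_1I[OF p eq' y n] p(1) not_prime_unit by auto
  qed
  thus ?thesis by (simp add: hilbert_add_def)
qed

lemma norm_symbol_conv_hilbert_add:
  fixes p q n :: int
  assumes p: "prime p" "odd p" and n: "squarefree n" "p dvd n" and q: "prime q"
  shows "norm_symbol n p q = (if even (hilbert_add p q (- n)) then 1 else -1)"
proof (cases "p = q")
  case True
  have n': "\<not> p dvd n div p" and pn: "p * (n div p) = n" using not_dvd_div_squarefree p n by auto
  have "norm_symbol n p q = Legendre (n div p) p" using True p(1) by (simp add: norm_symbol_def)
  moreover have "hilbert_add p q (- n) = (if Legendre (n div p) p = 1 then 0 else 1)"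
    using hilbert_add_uniformizer[OF p n'] unfolding pn True[symmetric] .
  ultimately show ?thesis using n' Legendre_cases[of "n div p" p]
    by (auto simp: Legendre_eq_0_iff)
next
  case False
  hence q': "\<not> p dvd q" using p q primes_dvd_imp_eq by blast
  have n': "\<not> p dvd n div p" and pn: "p * (n div p) = n" using not_dvd_div_squarefree p n by auto
  have "norm_symbol n p q = Legendre q p" using q' by (auto simp: norm_symbol_def)
  moreover have "hilbert_add p q (- n) = (if Legendre q p = 1 then 0 else 1)"
    using hilbert_add_unit[OF p n' q'] unfolding pn .
  ultimately show ?thesis using q' Legendre_cases[of q p]
    by (auto simp: Legendre_eq_0_iff)
qed

section \<open>Square classes and 2-torsion\<close>

lemma int_eq_multiplicityI:
  fixes a b :: int
  assumes "a \<noteq> 0" "b \<noteq> 0" "sgn a = sgn b" "\<And>p. prime p \<Longrightarrow> multiplicity p a = multiplicity p b"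
  shows "a = b"
proof -
  have "normalize a = normalize b" using assms by (intro multiplicity_eq_imp_eq) auto
  hence "\<bar>a\<bar> = \<bar>b\<bar>" by simp
  thus ?thesis using assms(3) by (metis abs_mult_sgn mult.commute)
qed

lemma sgn_squarefree_part: "a \<noteq> 0 \<Longrightarrow> sgn (squarefree_part a) = sgn (a::int)"
proof -
  assume "a \<noteq> 0"
  hence "square_part a ^ 2 > 0" by simp
  moreover have "sgn a = sgn (squarefree_part a) * sgn (square_part a ^ 2)"
    unfolding sgn_mult[symmetric] squarefree_decompose[symmetric] ..
  ultimately show ?thesis by (simp only: sgn_pos mult_1_right)
qed

lemma squarefree_part_squarefree:
  fixes d :: int
  assumes "squarefree d"
  shows "squarefree_part d = d"
proof (rule int_eq_multiplicityI)
  show "d \<noteq> 0" using assms by auto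
  thus "sgn (squarefree_part d) = sgn d" by (rule sgn_squarefree_part)
  fix p :: int assume p: "prime p"
  show "multiplicity p (squarefree_part d) = multiplicity p d"
    unfolding prime_multiplicity_squarefree_part[OF p] multiplicity_squarefree[OF p assms] by simp
qed simp

lemma squarefree_part_eqI:
  fixes a b :: int
  assumes "a \<noteq> 0" "b \<noteq> 0" and sq: "is_square (a * b)"
  shows "squarefree_part a = squarefree_part b"
proof (rule int_eq_multiplicityI)
  from sq obtain r where r: "a * b = r^2" by (elim is_nth_powerE)
  hence "r \<noteq> 0" using assms by auto
  hence "a * b > 0" using r by simp
  thus "sgn (squarefree_part a) = sgn (squarefree_part b)"
    using assms by (auto simp: sgn_squarefree_part zero_less_mult_iff)
  fix p :: int assume p: "prime p"
  have "multiplicity p a + multiplicity p b = 2 * multiplicity p r"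
    using arg_cong[OF r, of "multiplicity p"] prime_imp_prime_elem[OF p] assms \<open>r \<noteq> 0\<close>
    by (simp add: prime_elem_multiplicity_mult_distrib prime_elem_multiplicity_power_distrib)
  hence "multiplicity p a mod 2 = multiplicity p b mod 2" by presburger
  thus "multiplicity p (squarefree_part a) = multiplicity p (squarefree_part b)"
    using p by (simp add: prime_multiplicity_squarefree_part)
qed auto

text \<open>The definite description is meaningful: a square-free decomposition exists, and two
  square-free numbers whose product is a square coincide, sign included.\<close>

lemma sqcl_conv_squarefree_part:
  assumes "a \<noteq> 0"
  shows "sqcl a = squarefree_part a"
  unfolding sqcl_def
proof (rule the_equality)
  show "squarefree (squarefree_part a) \<and> (\<exists>s. s \<noteq> 0 \<and> a = squarefree_part a * s^2)"
    using assms squarefree_decompose[of a] by (metis mult_zero_right squarefree_squarefree_part zero_power2)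
next
  fix d assume "squarefree d \<and> (\<exists>s. s \<noteq> 0 \<and> a = d * s^2)"
  then obtain s where s: "squarefree d" "s \<noteq> 0" "a = d * s^2" by blast
  have "is_square (d * a)" unfolding s(3) by (rule is_nth_powerI[of _ "d * s"]) (simp add: power2_eq_square)
  hence "squarefree_part d = squarefree_part a" using assms s by (intro squarefree_part_eqI) auto
  thus "d = squarefree_part a" using s(1) by (simp add: squarefree_part_squarefree)
qed

lemma squarefree_sqcl: "a \<noteq> 0 \<Longrightarrow> squarefree (sqcl a)"
  by (simp add: sqcl_conv_squarefree_part)

lemma sqcl_nonzero: "a \<noteq> 0 \<Longrightarrow> sqcl a \<noteq> 0"
  by (simp add: sqcl_conv_squarefree_part)

lemma sqcl_decompose:
  assumes "a \<noteq> 0"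
  obtains s where "s \<noteq> 0" "a = sqcl a * s^2"
  using assms squarefree_decompose[of a]
  by (metis mult_zero_right sqcl_conv_squarefree_part zero_power2)

lemma sqcl_squarefree: "squarefree d \<Longrightarrow> sqcl d = d"
  using sqcl_conv_squarefree_part[of d] squarefree_part_squarefree[of d] by (cases "d = 0") auto

lemma sqcl_1 [simp]: "sqcl 1 = 1"
  by (simp add: sqcl_squarefree)

lemma sqcl_eq_iff:
  assumes "a \<noteq> 0" "b \<noteq> 0"
  shows "sqcl a = sqcl b \<longleftrightarrow> is_square (a * b)"
proof
  assume "is_square (a * b)"
  thus "sqcl a = sqcl b" using assms squarefree_part_eqI by (simp add: sqcl_conv_squarefree_part)
next
  assume eq: "sqcl a = sqcl b"
  obtain s t where "a = sqcl a * s^2" "b = sqcl b * t^2" using assms sqcl_decompose by metis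
  hence "a * b = (sqcl a * s * t)^2" unfolding eq by (simp add: power2_eq_square mult_ac)
  thus "is_square (a * b)" by (rule is_nth_powerI)
qed

lemma sqcl_eqI:
  assumes "a \<noteq> 0" "b \<noteq> 0" "a * b = r^2"
  shows "sqcl a = sqcl b"
  using assms sqcl_eq_iff is_nth_powerI by metis

lemma sqcl_mult_sqcl_right:
  assumes "a \<noteq> 0" "b \<noteq> 0"
  shows "sqcl (a * sqcl b) = sqcl (a * b)"
proof -
  obtain s where s: "b = sqcl b * s^2" using sqcl_decompose[OF assms(2)] by metis
  have "a * sqcl b * (a * b) = (a * sqcl b * s)^2"
    by (subst (2) s) (simp add: power2_eq_square mult_ac)
  thus ?thesis using assms sqcl_nonzero by (intro sqcl_eqI) auto
qed

text \<open>Positivity of x fixes the sign, so that y itself, and not -y, is the square; the rest is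
  the statement for naturals.\<close>

lemma is_square_mult_coprimeD:
  fixes x y :: int
  assumes "coprime x y" "x > 0" "y \<noteq> 0" "is_square (x * y)"
  shows "is_square x" "is_square y"
proof -
  from assms(4) obtain r where r: "x * y = r^2" by (elim is_nth_powerE)
  hence "x * y \<ge> 0" by simp
  hence y: "y > 0" using assms by (simp add: zero_le_mult_iff)
  have "nat x * nat y = nat \<bar>r\<bar> ^ 2"
    using r assms(2) y by (simp flip: nat_mult_distrib nat_power_eq)
  hence "is_square (nat x * nat y)" by (rule is_nth_powerI)
  moreover have "coprime (nat x) (nat y)" using assms(1,2) y by (simp flip: coprime_int_iff)
  ultimately have "is_square (nat x)" "is_square (nat y)"
    using assms(2) y by (simp_all add: is_nth_power_mult_coprime_nat_iff)
  then obtain v w where "nat x = v^2" "nat y = w^2" by (auto elim!: is_nth_powerE)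
  hence "x = int v ^ 2" "y = int w ^ 2" using assms(2) y by (metis int_nat_eq less_imp_le of_nat_power)+
  thus "is_square x" "is_square y" by (auto intro: is_nth_powerI)
qed

text \<open>If \<open>r\<close>, \<open>r - a\<^sup>2\<close>, \<open>r - b\<^sup>2\<close> are the roots of the cubic, then \<open>(r, 0)\<close> is the double of
  \<open>(r + a b, a b (a + b))\<close>, the tangent there having slope \<open>a + b\<close>.\<close>

lemma has_rat_point_order4I:
  fixes a b r :: int
  assumes ab: "a > 0" "b > 0"
    and c: "e2 - e1 = a^2 + b^2 - 3*r" "- e1 * e2 = 3*r^2 - 2*r*(a^2+b^2) + a^2*b^2" "r * (r - a^2) * (r - b^2) = 0"
  shows "has_rat_point_order4 e1 e2 1"
proof -
  define A B R :: rat where "A = of_int a" and "B = of_int b" and "R = of_int r"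
  define x where "x = R + A * B"
  define y where "y = A * B * (A + B)"
  have AB: "A > 0" "B > 0" using ab by (auto simp: A_def B_def)
  have 1: "of_int (e2 - e1) = A^2 + B^2 - 3 * R" unfolding c(1) by (simp add: A_def B_def R_def)
  have 2: "of_int (- e1 * e2) = 3*R^2 - 2*R*(A^2+B^2) + A^2*B^2" unfolding c(2) by (simp add: A_def B_def R_def)
  have 3: "R * (R - A^2) * (R - B^2) = 0"
    using arg_cong[OF c(3), of "of_int :: int \<Rightarrow> rat"] by (simp add: A_def B_def R_def)
  have y0: "y \<noteq> 0" using AB by (simp add: y_def)
  have "x * (x - of_int (e1*1)) * (x + of_int (e2*1)) = x^3 + of_int (e2 - e1) * x^2 + of_int (- e1 * e2) * x"
    by (simp add: power2_eq_square power3_eq_cube algebra_simps)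
  \<comment> \<open>The assumptions compare the coefficients of the cubic with those of (x - r)(x -
    r + a^2)(x - r + b^2). At x = r + a b this product equals (a b (a + b))^2, and the remaining
    term is zero by the condition on the constant coefficient.\<close>
  also have "\<dots> = y^2 + R * (R - A^2) * (R - B^2)"
    unfolding 1 2 x_def y_def by (simp add: power2_eq_square power3_eq_cube algebra_simps)
  finally have on: "on_curve e1 e2 1 x y" unfolding 3 on_curve_def by simp
  have slope: "(3 * x^2 + 2 * of_int ((e2 - e1) * 1) * x + of_int (- e1 * e2 * 1^2)) / (2 * y) = A + B"
  proof -
    have "3 * x^2 + 2 * of_int ((e2 - e1) * 1) * x + of_int (- e1 * e2 * 1^2)
        = 3 * x^2 + 2 * (A^2 + B^2 - 3 * R) * x + (3*R^2 - 2*R*(A^2+B^2) + A^2*B^2)"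
      using 1 2 by simp
    also have "\<dots> = (A + B) * (2 * y)"
      unfolding x_def y_def by (simp add: power2_eq_square algebra_simps)
    finally show ?thesis using y0 by simp
  qed
  have dx: "dbl_x e1 e2 1 x y = R"
    unfolding dbl_x_def Let_def slope using 1 by (simp add: x_def power2_eq_square algebra_simps)
  have "dbl_y e1 e2 1 x y = 0"
    unfolding dbl_y_def Let_def slope dx by (simp add: x_def y_def algebra_simps)
  with on y0 show ?thesis unfolding has_rat_point_order4_def by blast
qed

lemma is_square_posE:
  fixes x :: int
  assumes "is_square x" "x \<noteq> 0"
  obtains a where "a > 0" "x = a^2"
proof -
  from assms(1) obtain a where a: "x = a^2" by (elim is_nth_powerE)
  hence "\<bar>a\<bar> > 0" "x = \<bar>a\<bar>^2" using assms(2) by auto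
  thus ?thesis using that by blast
qed

text \<open>The roots are e1, -e2 and 0. Each claim takes one of them, in this order, as
  \<open>r\<close> and assumes that its differences to the other two are squares: e1 and -e3, then
  -e2 and e3, then -e1 and e2.\<close>

lemma has_rat_point_order4_squares:
  assumes e: "e1 \<noteq> 0" "e2 \<noteq> 0" "e3 \<noteq> 0" "e1 + e2 + e3 = 0"
  shows "is_square e1 \<Longrightarrow> is_square (- e3) \<Longrightarrow> has_rat_point_order4 e1 e2 1"
    and "is_square e3 \<Longrightarrow> is_square (- e2) \<Longrightarrow> has_rat_point_order4 e1 e2 1"
    and "is_square e2 \<Longrightarrow> is_square (- e1) \<Longrightarrow> has_rat_point_order4 e1 e2 1"
proof -
  assume "is_square e1" "is_square (- e3)"
  then obtain a b where ab: "a > 0" "b > 0" "e1 = a^2" "- e3 = b^2" using e by (metis is_square_posE neg_equal_0_iff_equal)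
  hence e2: "e2 = b^2 - a^2" using e by simp
  show "has_rat_point_order4 e1 e2 1"
    by (rule has_rat_point_order4I[OF ab(1,2), of _ _ "a^2"])
      (simp_all add: e2 ab(3) power2_eq_square algebra_simps)
next
  assume "is_square e3" "is_square (- e2)"
  then obtain a b where ab: "a > 0" "b > 0" "e3 = a^2" "- e2 = b^2" using e by (metis is_square_posE neg_equal_0_iff_equal)
  hence e2: "e2 = - (b^2)" and e1: "e1 = b^2 - a^2" using e by simp_all
  show "has_rat_point_order4 e1 e2 1"
    by (rule has_rat_point_order4I[OF ab(1,2), of _ _ "b^2"])
      (simp_all add: e1 e2 power2_eq_square algebra_simps)
next
  assume "is_square e2" "is_square (- e1)"
  then obtain a b where ab: "a > 0" "b > 0" "e2 = a^2" "- e1 = b^2" using e by (metis is_square_posE neg_equal_0_iff_equal)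
  hence e1: "e1 = - (b^2)" by simp
  show "has_rat_point_order4 e1 e2 1"
    by (rule has_rat_point_order4I[OF ab(1,2), of _ _ 0])
      (simp_all add: e1 ab(3) power2_eq_square algebra_simps)
qed

text \<open>The triple of a 2-torsion point of \<open>E\<^bsup>(m)\<^esup>\<close> is \<open>(\<alpha>\<^sub>i m^g\<^sub>i)\<^sub>i\<close> with \<open>\<alpha>\<close> independent of \<open>m\<close>
  and \<open>g\<^sub>i \<in> {0,1}\<close>.\<close>

definition tors_data :: "int \<Rightarrow> int \<Rightarrow> int \<Rightarrow> ((int \<times> int \<times> int) \<times> (nat \<times> nat \<times> nat)) set" where
  "tors_data e1 e2 e3 = {((1, 1, 1), (0, 0, 0)), ((- e3, - e1 * e3, e1), (1, 0, 1)),
     ((- e2 * e3, e3, - e2), (0, 1, 1)), ((e2, - e1, - e1 * e2), (1, 1, 0))}"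

definition tors_triple :: "int \<Rightarrow> ((int \<times> int \<times> int) \<times> (nat \<times> nat \<times> nat)) \<Rightarrow> int \<times> int \<times> int" where
  "tors_triple m = (\<lambda>((a1, a2, a3), (g1, g2, g3)). (sqcl (a1 * m^g1), sqcl (a2 * m^g2), sqcl (a3 * m^g3)))"

lemma tors2_conv_tors_data: "tors2 e1 e2 e3 m = tors_triple m ` tors_data e1 e2 e3"
  by (simp add: tors2_def tors_data_def tors_triple_def)

text \<open>If two torsion points had the same triple, their difference would be a nonzero torsion
  point with trivial triple. Its two square conditions make it twice a rational point, which yields
  a point of order 4.\<close>

lemma inj_on_tors_triple:
  assumes e: "e1 \<noteq> 0" "e2 \<noteq> 0" "e3 \<noteq> 0" "e1 + e2 + e3 = 0"
    and no4: "\<not> has_rat_point_order4 e1 e2 1"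
  shows "inj_on (tors_triple 1) (tors_data e1 e2 e3)" "card (tors_data e1 e2 e3) = 4"
proof -
  have n1: "\<not> (is_square e1 \<and> is_square (- e3))" and n2: "\<not> (is_square e3 \<and> is_square (- e2))"
    and n3: "\<not> (is_square e2 \<and> is_square (- e1))"
    using has_rat_point_order4_squares[OF e] no4 by blast+
  have canc: "is_square b" if "is_square (a^2 * b)" "a \<noteq> 0" for a b :: int
    using that by (simp add: is_nth_power_mult_cancel_left)
  define t0 t1 t2 t3 where "t0 = ((1::int, 1::int, 1::int), (0::nat, 0::nat, 0::nat))"
    and "t1 = ((- e3, - e1 * e3, e1), (1::nat, 0::nat, 1::nat))"
    and "t2 = ((- e2 * e3, e3, - e2), (0::nat, 1::nat, 1::nat))"
    and "t3 = ((e2, - e1, - e1 * e2), (1::nat, 1::nat, 0::nat))"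
  note t = t0_def t1_def t2_def t3_def
  have T: "tors_data e1 e2 e3 = {t0, t1, t2, t3}" by (simp add: tors_data_def t)
  note S = tors_triple_def t sqcl_eq_iff e
  have 01: "tors_triple 1 t0 \<noteq> tors_triple 1 t1"
    using n1 by (auto simp: S simp del: sqcl_1)
  have 02: "tors_triple 1 t0 \<noteq> tors_triple 1 t2"
    using n2 by (auto simp: S simp del: sqcl_1)
  have 03: "tors_triple 1 t0 \<noteq> tors_triple 1 t3"
    using n3 by (auto simp: S simp del: sqcl_1)
  have 12: "tors_triple 1 t1 \<noteq> tors_triple 1 t2"
  proof
    assume "tors_triple 1 t1 = tors_triple 1 t2"
    hence "is_square (- e3 * (- e2 * e3))" "is_square (- e1 * e3 * e3)" by (simp_all add: S)
    \<comment> \<open>Cancelling e3^2 leaves the square conditions of the third torsion point, the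
      difference of the two being compared.\<close>
    hence "is_square (e3^2 * e2)" "is_square (e3^2 * (- e1))" by (simp_all add: power2_eq_square mult_ac)
    thus False using canc e n3 by blast
  qed
  have 13: "tors_triple 1 t1 \<noteq> tors_triple 1 t3"
  proof
    assume "tors_triple 1 t1 = tors_triple 1 t3"
    hence "is_square (- e1 * e3 * (- e1))" "is_square (e1 * (- e1 * e2))" by (simp_all add: S)
    hence "is_square (e1^2 * e3)" "is_square (e1^2 * (- e2))" by (simp_all add: power2_eq_square mult_ac)
    thus False using canc e n2 by blast
  qed
  have 23: "tors_triple 1 t2 \<noteq> tors_triple 1 t3"
  proof
    assume "tors_triple 1 t2 = tors_triple 1 t3"
    hence "is_square (- e2 * e3 * e2)" "is_square (- e2 * (- e1 * e2))" by (simp_all add: S)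
    hence "is_square (e2^2 * (- e3))" "is_square (e2^2 * e1)" by (simp_all add: power2_eq_square mult_ac)
    thus False using canc e n1 by blast
  qed
  note D = 01 02 03 12 13 23
  show "inj_on (tors_triple 1) (tors_data e1 e2 e3)"
    unfolding T inj_on_def using D D[symmetric] by blast
  have "t0 \<noteq> t1" "t0 \<noteq> t2" "t0 \<noteq> t3" "t1 \<noteq> t2" "t1 \<noteq> t3" "t2 \<noteq> t3" using D by metis+
  thus "card (tors_data e1 e2 e3) = 4" unfolding T by simp
qed

text \<open>A coordinate equal to 1 makes a global integral solution primitive at every prime at
  once.\<close>

lemma Sel2_memI_global_point:
  assumes sf: "squarefree d1" "squarefree d2" "squarefree d3" and s: "d1 * d2 * d3 = s^2"
    and pr: "t = 1 \<or> u1 = 1"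
    and eq: "e1*m*t^2 + d2*u2^2 - d3*u3^2 = 0" "e2*m*t^2 + d3*u3^2 - d1*u1^2 = 0" "e3*m*t^2 + d1*u1^2 - d2*u2^2 = 0"
  shows "(d1, d2, d3) \<in> Sel2 e1 e2 e3 m"
proof -
  have "D_real_solvable e1 e2 e3 m (d1, d2, d3)"
    unfolding D_real_solvable_def prod.case
    by (rule exI[of _ "real_of_int t"], rule exI[of _ "real_of_int u1"], rule exI[of _ "real_of_int u2"], rule exI[of _ "real_of_int u3"])
      (use pr eq[THEN arg_cong[of _ _ real_of_int]] in auto)
  moreover have "padic_solvable p 4 (D_eqs e1 e2 e3 m (d1, d2, d3))" if "prime p" for p
    unfolding padic_solvable_D_iff
    by (intro allI, rule exI[of _ t], rule exI[of _ u1], rule exI[of _ u2], rule exI[of _ u3])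
      (use eq pr that not_prime_unit[of p] in auto)
  ultimately show ?thesis using sf s unfolding Sel2_def D_adelic_solvable_def by auto
qed

text \<open>Before reduction to square-free entries, the triple of a nonzero torsion point has a
  solution with t = 1, one u_i equal to 0 and the others 1. The square factors lost in
  \<open>sqcl\<close> are absorbed into the u_i.\<close>

lemma tors2_subset_Sel2:
  assumes e: "e1 \<noteq> 0" "e2 \<noteq> 0" "e3 \<noteq> 0" "e1 + e2 + e3 = 0"
  shows "tors2 e1 e2 e3 1 \<subseteq> Sel2 e1 e2 e3 1"
proof -
  have *: "(sqcl a1, sqcl a2, sqcl a3) \<in> Sel2 e1 e2 e3 1"
    if nz: "a1 \<noteq> 0" "a2 \<noteq> 0" "a3 \<noteq> 0" and r: "a1 * a2 * a3 = r^2"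
      and eq: "e1 + a2*u2^2 - a3*u3^2 = 0" "e2 + a3*u3^2 - a1*u1^2 = 0" "e3 + a1*u1^2 - a2*u2^2 = 0"
    for a1 a2 a3 r u1 u2 u3
  proof -
    define c1 c2 c3 where c: "c1 = sqcl a1" "c2 = sqcl a2" "c3 = sqcl a3"
    obtain s1 where s1: "s1 \<noteq> 0" "a1 = c1 * s1^2" using sqcl_decompose[OF nz(1)] unfolding c .
    obtain s2 where s2: "s2 \<noteq> 0" "a2 = c2 * s2^2" using sqcl_decompose[OF nz(2)] unfolding c .
    obtain s3 where s3: "s3 \<noteq> 0" "a3 = c3 * s3^2" using sqcl_decompose[OF nz(3)] unfolding c .
    have "(s1 * s2 * s3)^2 * (c1 * c2 * c3) = a1 * a2 * a3"
      unfolding s1(2) s2(2) s3(2) by (simp add: power2_eq_square mult_ac)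
    hence "is_square ((s1 * s2 * s3)^2 * (c1 * c2 * c3))" unfolding r by simp
    hence "is_square (c1 * c2 * c3)"
      using s1(1) s2(1) s3(1) by (simp add: is_nth_power_mult_cancel_left)
    then obtain q where q: "c1 * c2 * c3 = q^2" by (elim is_nth_powerE)
    have "c1 * (s1*u1)^2 = a1 * u1^2" "c2 * (s2*u2)^2 = a2 * u2^2" "c3 * (s3*u3)^2 = a3 * u3^2"
      unfolding s1(2) s2(2) s3(2) by (simp_all add: power_mult_distrib)
    moreover have "squarefree c1" "squarefree c2" "squarefree c3" using nz by (simp_all add: c squarefree_sqcl)
    ultimately have "(c1, c2, c3) \<in> Sel2 e1 e2 e3 1" using eq
      by (intro Sel2_memI_global_point[OF _ _ _ q, of 1 "s1*u1" _ _ "s2*u2" "s3*u3"]) simp_all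
    thus ?thesis by (simp add: c)
  qed
  have "(1, 1, 1) \<in> Sel2 e1 e2 e3 1"
    by (rule Sel2_memI_global_point[of 1 1 1 1 0 1 _ _ 1 1]) auto
  moreover have "(sqcl (- e3), sqcl (- e1 * e3), sqcl e1) \<in> Sel2 e1 e2 e3 1"
    using e by (intro *[of _ _ _ "e1 * e3" 0 1 1]) (auto simp: power2_eq_square)
  moreover have "(sqcl (- e2 * e3), sqcl e3, sqcl (- e2)) \<in> Sel2 e1 e2 e3 1"
    using e by (intro *[of _ _ _ "e2 * e3" 1 1 0]) (auto simp: power2_eq_square)
  moreover have "(sqcl e2, sqcl (- e1), sqcl (- e1 * e2)) \<in> Sel2 e1 e2 e3 1"
    using e by (intro *[of _ _ _ "e1 * e2" 1 0 1]) (auto simp: power2_eq_square)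
  ultimately show ?thesis by (simp add: tors2_def)
qed

lemma Sel2_eq_tors2:
  assumes e: "e1 \<noteq> 0" "e2 \<noteq> 0" "e3 \<noteq> 0" "e1 + e2 + e3 = 0"
    and no4: "\<not> has_rat_point_order4 e1 e2 1" and card: "card (Sel2 e1 e2 e3 1) = 4"
  shows "Sel2 e1 e2 e3 1 = tors2 e1 e2 e3 1"
proof -
  have "card (tors2 e1 e2 e3 1) = 4"
    unfolding tors2_conv_tors_data using inj_on_tors_triple[OF e no4] by (simp add: card_image)
  moreover have "finite (Sel2 e1 e2 e3 1)" using card by (intro card_ge_0_finite) simp
  ultimately show ?thesis using card tors2_subset_Sel2[OF e] by (metis card_subset_eq)
qed

section \<open>The descent from the twist to the original curve\<close>

lemma sqcl_pos: "a > 0 \<Longrightarrow> sqcl a > 0"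
  using sgn_squarefree_part[of a] by (simp add: sqcl_conv_squarefree_part sgn_if split: if_splits)

lemma multiplicity_sqcl:
  assumes "prime p" "a \<noteq> 0"
  shows "multiplicity p (sqcl a) = multiplicity p a mod 2"
  using assms by (simp add: sqcl_conv_squarefree_part prime_multiplicity_squarefree_part)

lemma squarefree_dvdI:
  fixes d n :: int
  assumes "squarefree d" "n \<noteq> 0" "\<And>p. prime p \<Longrightarrow> p dvd d \<Longrightarrow> p dvd n"
  shows "d dvd n"
proof (rule multiplicity_le_imp_dvd)
  show "d \<noteq> 0" using assms by auto
  fix p :: int assume p: "prime p"
  show "multiplicity p d \<le> multiplicity p n"
  proof (cases "p dvd d")
    case True
    hence "multiplicity p n > 0"
      using assms p prime_imp_prime_elem[OF p] by (simp add: prime_multiplicity_gt_zero_iff)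
    thus ?thesis using multiplicity_squarefree[OF p assms(1)] by simp
  qed (simp add: not_dvd_imp_multiplicity_0)
qed

lemma sqcl_dvdI:
  assumes "a \<noteq> 0" "n \<noteq> 0" "\<And>p. prime p \<Longrightarrow> p dvd a \<Longrightarrow> p dvd n"
  shows "sqcl a dvd n"
proof (rule squarefree_dvdI)
  show "squarefree (sqcl a)" using assms by (simp add: squarefree_sqcl)
  fix p assume p: "prime p" "p dvd sqcl a"
  have "sqcl a dvd a" using sqcl_decompose[OF assms(1)] by (metis dvd_triv_left)
  thus "p dvd n" using assms p by (meson dvd_trans)
qed (use assms in auto)

definition pos_divisor :: "int \<Rightarrow> int \<Rightarrow> bool" where
  "pos_divisor n d \<longleftrightarrow> d > 0 \<and> d dvd n"

lemma pos_divisor_sqcl_mult: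
  assumes "n > 0" "pos_divisor n a" "pos_divisor n b"
  shows "pos_divisor n (sqcl (a * b))"
  unfolding pos_divisor_def
proof
  show "sqcl (a * b) > 0" using assms by (intro sqcl_pos) (simp add: pos_divisor_def)
  show "sqcl (a * b) dvd n"
    using assms by (intro sqcl_dvdI) (auto simp: pos_divisor_def prime_dvd_mult_iff intro: dvd_trans)
qed

text \<open>The conditions are put on all prime divisors of n, so that the descent does not depend
  on an ordering of the primes; the list enters in \<open>square_twist_primes\<close>.\<close>

locale square_twist =
  fixes e1 e2 e3 n :: int
  assumes e_nz: "e1 \<noteq> 0" "e2 \<noteq> 0" "e3 \<noteq> 0" and e_sum: "e1 + e2 + e3 = 0"
    and n_pos: "n > 0" and n_sf: "squarefree n" and n_cop: "coprime n (e1 * e2 * e3)"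
    and n_res: "\<And>p q. prime p \<Longrightarrow> p dvd n \<Longrightarrow> prime q \<Longrightarrow> odd q \<Longrightarrow> q dvd e1 * e2 * e3 \<Longrightarrow> QuadRes q p"
    and n_mod8: "\<And>p. prime p \<Longrightarrow> p dvd n \<Longrightarrow> [p = 1] (mod 8)"
begin

lemma prime_dvd_not_dvd:
  assumes "prime p" "p dvd n"
  shows "\<not> p dvd e1 * e2 * e3"
proof
  assume "p dvd e1 * e2 * e3"
  hence "p dvd 1" using n_cop assms(2) by (metis coprime_def)
  thus False using assms(1) not_prime_unit by blast
qed

lemma prime_dvd_odd:
  assumes "prime p" "p dvd n"
  shows "odd p"
  using n_mod8[OF assms] by (auto simp: cong_def) presburger

lemma prime_dvd_Legendre_minus_1:
  assumes "prime p" "p dvd n"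
  shows "Legendre (-1) p = 1"
proof (rule Legendre_minus_1)
  show "[p = 1] (mod 4)" using n_mod8[OF assms] by (rule cong_dvd_modulus) simp
qed fact

text \<open>By multiplicativity only -1, 2 and odd primes matter. The first two are residues because
  p = 1 modulo 8, the odd ones by reciprocity from \<open>n_res\<close>.\<close>

lemma Legendre_dvd_e:
  assumes p: "prime p" "p dvd n" and x: "x dvd e1 * e2 * e3"
  shows "Legendre x p = 1"
  using x
proof (induction x rule: prime_divisors_induct)
  case zero
  thus ?case using e_nz by simp
next
  case (unit x)
  hence "x = 1 \<or> x = -1" by auto
  thus ?case using p Legendre_1 prime_dvd_Legendre_minus_1 by auto
next
  case (factor q x)
  have qd: "q dvd e1 * e2 * e3" and xd: "x dvd e1 * e2 * e3"
    using factor.prems by (auto dest: dvd_mult_left dvd_mult_right)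
  have "Legendre q p = 1"
  proof (cases "q = 2")
    case True
    thus ?thesis using Legendre_2[OF p(1) n_mod8[OF p]] by simp
  next
    case False
    hence "odd q" using factor.hyps primes_dvd_imp_eq[of 2 q] by auto
    moreover have "[p = 1] (mod 4)" using n_mod8[OF p] by (rule cong_dvd_modulus) simp
    moreover have "p \<noteq> q" using prime_dvd_not_dvd[OF p] qd by auto
    ultimately show ?thesis using p factor.hyps n_res[OF p] qd by (intro Legendre_flip) auto
  qed
  thus ?case using factor.IH[OF xd] p prime_dvd_odd by (simp add: Legendre_mult)
qed

lemma bad_prime_not_dvd:
  assumes "prime p" "p = 2 \<or> p dvd e1 * e2 * e3"
  shows "\<not> p dvd n"
  using assms prime_dvd_odd prime_dvd_not_dvd by fastforce

text \<open>The mirror image of \<open>Legendre_dvd_e\<close>: each prime factor of n is 1 modulo 8,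
  hence a 2-adic square, and is a residue modulo odd bad primes by assumption. Positivity removes
  the factor -1.\<close>

lemma pos_divisor_square_mod:
  assumes p: "prime p" "p = 2 \<or> p dvd e1 * e2 * e3" and x: "pos_divisor n x"
  shows "\<exists>s. [s^2 = x] (mod p^k)"
  using x
proof (induction x rule: prime_divisors_induct)
  case zero
  thus ?case by (simp add: pos_divisor_def)
next
  case (unit x)
  hence "x = 1" by (auto simp: pos_divisor_def)
  thus ?case by (auto intro: exI[of _ 1])
next
  case (factor q x)
  have q0: "q > 0" using factor.hyps prime_gt_0_int by blast
  have qd: "q dvd n" and xd: "pos_divisor n x"
    using factor.prems q0 by (auto simp: pos_divisor_def zero_less_mult_iff dest: dvd_mult_left dvd_mult_right)
  have "\<exists>s. [s^2 = q] (mod p^k)"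
  proof (cases "p = 2")
    case True
    thus ?thesis using square_mod_two_power n_mod8 factor.hyps qd by blast
  next
    case False
    hence o: "odd p" using p primes_dvd_imp_eq[of 2 p] by auto
    have pe: "p dvd e1 * e2 * e3" using p False by simp
    have "\<not> p dvd q" using primes_dvd_imp_eq[of p q] p factor.hyps prime_dvd_not_dvd qd pe by blast
    hence "Legendre q p = 1" using n_res[OF factor.hyps qd p(1) o pe] by (simp add: Legendre_eq_1_iff)
    thus ?thesis using square_mod_prime_power p(1) o by blast
  qed
  moreover obtain t where "[t^2 = x] (mod p^k)" using factor.IH[OF xd] by blast
  ultimately obtain s where "[s^2 = q] (mod p^k)" by blast
  with \<open>[t^2 = x] (mod p^k)\<close> have "[(s * t)^2 = q * x] (mod p^k)"
    by (simp add: power_mult_distrib cong_mult)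
  thus ?case by blast
qed

lemma Sel2_pos_divisor_iff:
  assumes d: "pos_divisor n d1" "pos_divisor n d2" "pos_divisor n d3" and s: "d1 * d2 * d3 = s^2"
  shows "(d1, d2, d3) \<in> Sel2 e1 e2 e3 n \<longleftrightarrow>
    (\<forall>p. prime p \<longrightarrow> p dvd n \<longrightarrow> norm_symbol n p d1 = 1 \<and> norm_symbol n p d2 = 1)"
proof -
  have dv: "d1 > 0" "d2 > 0" "d3 > 0" "d1 dvd n" "d2 dvd n" "d3 dvd n"
    using d by (auto simp: pos_divisor_def)
  have sf: "squarefree d1" "squarefree d2" "squarefree d3" using dv squarefree_mono n_sf by blast+
  \<comment> \<open>The real analogue of \<open>padic_solvable_D_squares\<close>: a point at t =
    0.\<close>
  have real: "D_real_solvable e1 e2 e3 n (d1, d2, d3)"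
    unfolding D_real_solvable_def prod.case
    by (rule exI[of _ 0], rule exI[of _ "1 / sqrt d1"], rule exI[of _ "1 / sqrt d2"], rule exI[of _ "1 / sqrt d3"])
      (use dv in \<open>simp add: power_divide\<close>)
  have ram: "padic_solvable p 4 (D_eqs e1 e2 e3 n (d1, d2, d3)) \<longleftrightarrow> norm_symbol n p d1 = 1 \<and> norm_symbol n p d2 = 1"
    if "prime p" "p dvd n" for p
    using that prime_dvd_odd prime_dvd_Legendre_minus_1 n_sf e_sum sf s
    by (intro padic_solvable_D_norm_symbol Legendre_dvd_e) auto
  have unram: "padic_solvable p 4 (D_eqs e1 e2 e3 n (d1, d2, d3))" if p: "prime p" "\<not> p dvd n" for p
  proof -
    have nd: "\<not> p dvd d1" "\<not> p dvd d2" "\<not> p dvd d3" using dv p by (meson dvd_trans)+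
    show ?thesis
    proof (cases "p = 2 \<or> p dvd e1 * e2 * e3")
      case True
      show ?thesis using nd True p d by (intro padic_solvable_D_squares pos_divisor_square_mod) auto
    next
      case False
      hence "odd p" using p primes_dvd_imp_eq[of 2 p] by auto
      moreover have "\<not> p dvd e1 * e2 * e3 * n" using False p by (simp add: prime_dvd_mult_iff)
      ultimately show ?thesis using p nd s e_sum by (intro padic_solvable_D_unramified) auto
    qed
  qed
  have "D_adelic_solvable e1 e2 e3 n (d1, d2, d3) \<longleftrightarrow>
    (\<forall>p. prime p \<longrightarrow> p dvd n \<longrightarrow> norm_symbol n p d1 = 1 \<and> norm_symbol n p d2 = 1)"
    unfolding D_adelic_solvable_def using real ram unram by blast
  thus ?thesis using dv sf s unfolding Sel2_def by auto
qed

text \<open>With b_i = gcd(d_i, n), scaling t by sqrt(n) and u_i by sqrt(b_i) turns a point on the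
  covering of E^(n) for d into one on the covering of E for a. These roots exist over the reals and,
  modulo every power, at the primes dividing 2 e1 e2 e3.\<close>

lemma Sel2_coprime_part:
  assumes L: "(d1, d2, d3) \<in> Sel2 e1 e2 e3 n"
  obtains a1 a2 a3 b1 b2 b3 where "d1 = a1 * b1" "d2 = a2 * b2" "d3 = a3 * b3"
    "pos_divisor n b1" "pos_divisor n b2" "pos_divisor n b3" "coprime a1 n" "coprime a2 n" "coprime a3 n"
    "(a1, a2, a3) \<in> Sel2 e1 e2 e3 1"
proof -
  from L obtain s where sf: "squarefree d1" "squarefree d2" "squarefree d3" and s: "d1 * d2 * d3 = s^2"
    and D: "D_real_solvable e1 e2 e3 n (d1, d2, d3)"
      "\<And>p. prime p \<Longrightarrow> padic_solvable p 4 (D_eqs e1 e2 e3 n (d1, d2, d3))"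
    unfolding Sel2_def D_adelic_solvable_def by auto
  have split: "\<exists>a b. d = a * b \<and> pos_divisor n b \<and> coprime a n" if "squarefree d" for d
  proof (intro exI conjI)
    define b where "b = gcd d n"
    show "d = d div b * b" by (simp add: b_def)
    show "pos_divisor n b" using n_pos by (simp add: pos_divisor_def b_def)
    show "coprime (d div b) n"
    proof (rule ccontr)
      assume "\<not> coprime (d div b) n"
      then obtain c where c: "c dvd d div b" "c dvd n" "\<not> is_unit c" by (elim not_coprimeE)
      have "c \<noteq> 0" using c n_pos by auto
      then obtain p where "prime p" "p dvd c" using c prime_divisor_exists by blast
      hence p: "prime p" "p dvd d div b" "p dvd n" using c by (auto intro: dvd_trans)
      \<comment> \<open>Such a p divides both d and n, hence their gcd b. Together with p | d/b this
        gives p^2 | d, against square-freeness.\<close>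
      have "p dvd b" using p unfolding b_def
        by (metis dvd_div_mult_self dvd_mult2 gcd_dvd1 gcd_greatest b_def)
      hence "p * p dvd d div b * b" using p by (intro mult_dvd_mono)
      hence "p^2 dvd d" by (simp add: b_def power2_eq_square)
      thus False using that p not_prime_unit squarefreeD by blast
    qed
  qed
  obtain a1 b1 where 1: "d1 = a1 * b1" "pos_divisor n b1" "coprime a1 n" using split sf by blast
  obtain a2 b2 where 2: "d2 = a2 * b2" "pos_divisor n b2" "coprime a2 n" using split sf by blast
  obtain a3 b3 where 3: "d3 = a3 * b3" "pos_divisor n b3" "coprime a3 n" using split sf by blast
  have sfa: "squarefree a1" "squarefree a2" "squarefree a3"
    using sf squarefree_multD unfolding 1 2 3 by blast+
  have b: "b1 > 0" "b2 > 0" "b3 > 0" "b1 dvd n" "b2 dvd n" "b3 dvd n"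
    using 1 2 3 by (auto simp: pos_divisor_def)
  have "is_square ((b1 * b2 * b3) * (a1 * a2 * a3))"
    using s unfolding 1 2 3 by (intro is_nth_powerI[of _ s]) (simp add: mult_ac)
  moreover have "coprime (b1 * b2 * b3) (a1 * a2 * a3)"
  proof -
    have "coprime b a" if "b dvd n" "coprime a n" for a b
      using that by (meson coprime_commute coprime_divisors dvd_refl)
    thus ?thesis using b 1 2 3 by simp
  qed
  moreover have "a1 \<noteq> 0" "a2 \<noteq> 0" "a3 \<noteq> 0" using sfa by auto
  ultimately have "is_square (a1 * a2 * a3)"
    using b is_square_mult_coprimeD(2)[of "b1 * b2 * b3" "a1 * a2 * a3"] by auto
  then obtain q where q: "a1 * a2 * a3 = q^2" by (elim is_nth_powerE)
  have real: "D_real_solvable e1 e2 e3 1 (a1, a2, a3)"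
  proof -
    from D(1) obtain t u1 u2 u3 :: real where nz: "(t,u1,u2,u3) \<noteq> (0,0,0,0)"
      and eq: "e1*n*t^2 + d2*u2^2 - d3*u3^2 = 0" "e2*n*t^2 + d3*u3^2 - d1*u1^2 = 0" "e3*n*t^2 + d1*u1^2 - d2*u2^2 = 0"
      unfolding D_real_solvable_def by auto
    have nz': "(sqrt n * t, sqrt b1 * u1, sqrt b2 * u2, sqrt b3 * u3) \<noteq> (0, 0, 0, 0)"
      using nz n_pos b by simp
    have sq: "(sqrt b * u)^2 = b * u^2" if "b > 0" for b u :: real
      using that by (simp add: power_mult_distrib)
    have "n > (0::real)" "b1 > (0::real)" "b2 > (0::real)" "b3 > (0::real)" using n_pos b by simp_all
    note sq' = this[THEN sq]
    have "e1 * (sqrt n * t)^2 + a2 * (sqrt b2 * u2)^2 - a3 * (sqrt b3 * u3)^2 = 0"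
         "e2 * (sqrt n * t)^2 + a3 * (sqrt b3 * u3)^2 - a1 * (sqrt b1 * u1)^2 = 0"
         "e3 * (sqrt n * t)^2 + a1 * (sqrt b1 * u1)^2 - a2 * (sqrt b2 * u2)^2 = 0"
      using eq unfolding sq' by (simp_all add: 1 2 3 mult.assoc)
    thus ?thesis
      using nz' unfolding D_real_solvable_def prod.case of_int_1 mult_1_right by blast
  qed
  have padic: "padic_solvable p 4 (D_eqs e1 e2 e3 1 (a1, a2, a3))" if p: "prime p" for p
  proof (cases "p = 2 \<or> p dvd e1 * e2 * e3")
    case False
    hence o: "odd p" using p primes_dvd_imp_eq[of 2 p] by auto
    \<comment> \<open>Elsewhere it suffices that a is unramified. For p | n this is coprimality; for
      other p it follows from the local point for d.\<close>
    have "\<not> p dvd a1 \<and> \<not> p dvd a2 \<and> \<not> p dvd a3"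
    proof (cases "p dvd n")
      case True
      have "\<not> p dvd a" if "coprime a n" for a
        using that True p not_prime_unit by (metis coprime_def)
      thus ?thesis using 1 2 3 by blast
    next
      case False
      hence "\<not> p dvd e1 * e2 * e3 * n" using \<open>\<not> (p = 2 \<or> _)\<close> p by (simp add: prime_dvd_mult_iff)
      thus ?thesis using padic_solvable_D_imp_unramified[OF p e_sum _ sf s D(2)[OF p]] unfolding 1 2 3 by auto
    qed
    thus ?thesis using False p o e_sum q by (intro padic_solvable_D_unramified) auto
  next
    case True
    show ?thesis
      unfolding padic_solvable_D_iff
    proof
      fix k
      obtain t u1 u2 u3 where pr: "\<not> p dvd t \<or> \<not> p dvd u1 \<or> \<not> p dvd u2 \<or> \<not> p dvd u3" and
        eq: "p^k dvd e1*n*t^2 + d2*u2^2 - d3*u3^2"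
            "p^k dvd e2*n*t^2 + d3*u3^2 - d1*u1^2"
            "p^k dvd e3*n*t^2 + d1*u1^2 - d2*u2^2"
        using D(2)[OF p] unfolding padic_solvable_D_iff by blast
      have sq: "\<exists>s. [s^2 = x] (mod p^k) \<and> \<not> p dvd s" if x: "pos_divisor n x" for x
      proof -
        obtain s where s: "[s^2 = x] (mod p^(Suc k))" using pos_divisor_square_mod[OF p True x] by blast
        have "[s^2 = x] (mod p)" using s by (rule cong_dvd_modulus) simp
        moreover have "\<not> p dvd x" using bad_prime_not_dvd[OF p True] x by (auto simp: pos_divisor_def intro: dvd_trans)
        ultimately have "\<not> p dvd s^2" using cong_dvd_iff by blast
        hence "\<not> p dvd s" by (auto simp: power2_eq_square)
        moreover have "[s^2 = x] (mod p^k)" using s by (rule cong_dvd_modulus) simp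
        ultimately show ?thesis by blast
      qed
      have "pos_divisor n n" using n_pos by (simp add: pos_divisor_def)
      then obtain r where r: "[r^2 = n] (mod p^k)" "\<not> p dvd r" using sq by blast
      obtain s1 where s1: "[s1^2 = b1] (mod p^k)" "\<not> p dvd s1" using sq 1 by blast
      obtain s2 where s2: "[s2^2 = b2] (mod p^k)" "\<not> p dvd s2" using sq 2 by blast
      obtain s3 where s3: "[s3^2 = b3] (mod p^k)" "\<not> p dvd s3" using sq 3 by blast
      have sc: "[a * (s * u)^2 = (a * b) * u^2] (mod p^k)" if "[s^2 = b] (mod p^k)" for a b s u
        using cong_mult[OF cong_refl[of "a * u^2"] that] by (simp add: power_mult_distrib mult_ac)
      have prim: "\<not> p dvd r * t \<or> \<not> p dvd s1 * u1 \<or> \<not> p dvd s2 * u2 \<or> \<not> p dvd s3 * u3"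
        using pr r s1 s2 s3 p by (auto simp: prime_dvd_mult_iff)
      have lift: "p^k dvd e*1*(r*t)^2 + a*(s*u)^2 - a'*(s'*u')^2"
        if "p^k dvd e*n*t^2 + a*b*u^2 - a'*b'*u'^2" "[s^2 = b] (mod p^k)" "[s'^2 = b'] (mod p^k)" for e a b u s a' b' u' s'
      proof -
        have "[e*(r*t)^2 + a*(s*u)^2 - a'*(s'*u')^2 = e*n*t^2 + a*b*u^2 - a'*b'*u'^2] (mod p^k)"
          using sc r(1) that by (intro cong_add cong_diff) auto
        thus ?thesis using that(1) cong_dvd_iff[of _ _ "p^k"] by simp
      qed
      show "\<exists>t u1 u2 u3. (\<not> p dvd t \<or> \<not> p dvd u1 \<or> \<not> p dvd u2 \<or> \<not> p dvd u3) \<and>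
        p^k dvd e1*1*t^2 + a2*u2^2 - a3*u3^2 \<and>
        p^k dvd e2*1*t^2 + a3*u3^2 - a1*u1^2 \<and>
        p^k dvd e3*1*t^2 + a1*u1^2 - a2*u2^2"
        by (rule exI[of _ "r*t"], rule exI[of _ "s1*u1"], rule exI[of _ "s2*u2"], rule exI[of _ "s3*u3"], intro conjI prim
              lift[OF eq(1)[unfolded 2 3] s2(1) s3(1)] lift[OF eq(2)[unfolded 3 1] s3(1) s1(1)]
              lift[OF eq(3)[unfolded 1 2] s1(1) s2(1)])
    qed
  qed
  have "(a1, a2, a3) \<in> Sel2 e1 e2 e3 1"
    unfolding Sel2_def D_adelic_solvable_def using sfa q real padic by auto
  with 1 2 3 show ?thesis using that by blast
qed

lemma pos_divisor_sqcl_mult_power: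
  assumes "pos_divisor n b"
  shows "pos_divisor n (sqcl (b * n^g))"
  unfolding pos_divisor_def
proof
  show "sqcl (b * n^g) > 0" using assms n_pos by (intro sqcl_pos) (simp add: pos_divisor_def)
  show "sqcl (b * n^g) dvd n"
    using assms n_pos
    by (intro sqcl_dvdI) (auto simp: pos_divisor_def prime_dvd_mult_iff intro: dvd_trans prime_dvd_power)
qed

text \<open>The factors b and n^g are positive and supported on n, so sign and coprime part of the
  product are those of a x. The class is represented by a positive divisor of n iff a x is a
  square.\<close>

lemma sqcl_coprime_part:
  assumes "squarefree a" "coprime a n" "pos_divisor n b" "x \<noteq> 0" "coprime x n"
  shows "pos_divisor n (sqcl (a * b * sqcl (x * n^g))) \<longleftrightarrow> sqcl x = a"
proof -
  have nz: "a \<noteq> 0" "b \<noteq> 0" "n \<noteq> 0" using assms n_pos by (auto simp: pos_divisor_def)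
  have eq: "sqcl (a * b * sqcl (x * n^g)) = sqcl (a * b * (x * n^g))"
    using nz assms by (intro sqcl_mult_sqcl_right) auto
  show ?thesis
  proof
    assume "sqcl x = a"
    moreover obtain s where "s \<noteq> 0" "x = sqcl x * s^2" using sqcl_decompose assms by blast
    ultimately have s: "x = a * s^2" by simp
    have "sqcl (a * b * (x * n^g)) = sqcl (b * n^g)"
      using nz assms s by (intro sqcl_eqI[of _ _ "a * s * b * n^g"]) (auto simp: power2_eq_square)
    thus "pos_divisor n (sqcl (a * b * sqcl (x * n^g)))"
      using pos_divisor_sqcl_mult_power assms eq by simp
  next
    define R where "R = sqcl (a * b * (x * n^g))"
    assume "pos_divisor n (sqcl (a * b * sqcl (x * n^g)))"
    hence R: "R > 0" "R dvd n" unfolding eq R_def by (auto simp: pos_divisor_def)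
    have "R = sqcl R" using R n_sf squarefree_mono sqcl_squarefree by metis
    hence "is_square (a * b * (x * n^g) * R)" using nz assms R by (subst sqcl_eq_iff[symmetric]) (auto simp: R_def)
    hence "is_square ((R * b * n^g) * (a * x))" by (simp add: mult_ac)
    moreover have "coprime (R * b * n^g) (a * x)"
    proof -
      have h: "coprime y z" if "y dvd n" "coprime z n" for y z
        using that by (meson coprime_commute coprime_divisors dvd_refl)
      have "b dvd n" using assms by (simp add: pos_divisor_def)
      thus ?thesis using h[OF R(2)] h[of b] h[of n] assms by simp
    qed
    ultimately have "is_square (a * x)"
      using R nz assms n_pos is_square_mult_coprimeD(2)[of "R * b * n^g" "a * x"] by (simp add: pos_divisor_def)
    hence "sqcl a = sqcl x" using nz assms by (simp add: sqcl_eq_iff)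
    thus "sqcl x = a" using assms by (simp add: sqcl_squarefree)
  qed
qed

text \<open>The translates made of positive divisors of n come exactly from those T whose triple on
  E equals the coprime part a. Existence of T is \<open>Sel2_eq_tors2\<close>; uniqueness is
  injectivity of the torsion triples.\<close>

lemma pure_class_representative:
  assumes no4: "\<not> has_rat_point_order4 e1 e2 1" and card: "card (Sel2 e1 e2 e3 1) = 4"
    and L: "L \<in> Sel2 e1 e2 e3 n"
  shows "\<exists>!R. R \<in> pure_class e1 e2 e3 n L \<and>
     (case R of (d1,d2,d3) \<Rightarrow> pos_divisor n d1 \<and> pos_divisor n d2 \<and> pos_divisor n d3)"
proof -
  obtain d1 d2 d3 where Ld: "L = (d1, d2, d3)" by (cases L)
  obtain a1 a2 a3 b1 b2 b3 where ab: "d1 = a1 * b1" "d2 = a2 * b2" "d3 = a3 * b3"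
    and b: "pos_divisor n b1" "pos_divisor n b2" "pos_divisor n b3"
    and cop: "coprime a1 n" "coprime a2 n" "coprime a3 n"
    and S: "(a1, a2, a3) \<in> Sel2 e1 e2 e3 1"
    using Sel2_coprime_part L unfolding Ld by metis
  have sf: "squarefree a1" "squarefree a2" "squarefree a3" using S by (auto simp: Sel2_def)
  define P where "P R \<longleftrightarrow> (case R of (d1,d2,d3) \<Rightarrow> pos_divisor n d1 \<and> pos_divisor n d2 \<and> pos_divisor n d3)" for R
  have ce: "coprime e1 n" "coprime e2 n" "coprime e3 n" using n_cop by (simp_all add: coprime_commute)
  have key: "P (tmul L (tors_triple n T)) \<longleftrightarrow> tors_triple 1 T = (a1, a2, a3)"
    if T: "T \<in> tors_data e1 e2 e3" for T
  proof -
    obtain x1 x2 x3 g1 g2 g3 where Tx: "T = ((x1, x2, x3), (g1, g2, g3))" by (cases T) auto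
    have "x1 \<noteq> 0" "x2 \<noteq> 0" "x3 \<noteq> 0" "coprime x1 n" "coprime x2 n" "coprime x3 n"
      using T e_nz ce unfolding Tx tors_data_def by auto
    thus ?thesis
      using sqcl_coprime_part sf cop b unfolding Tx Ld ab P_def
      by (simp add: tors_triple_def tmul_def)
  qed
  have "(a1, a2, a3) \<in> tors_triple 1 ` tors_data e1 e2 e3"
    using S Sel2_eq_tors2[OF e_nz e_sum no4 card] by (simp add: tors2_conv_tors_data)
  then obtain T where T: "T \<in> tors_data e1 e2 e3" "tors_triple 1 T = (a1, a2, a3)" by force
  have "\<exists>!R. R \<in> pure_class e1 e2 e3 n L \<and> P R"
  proof (rule ex1I[of _ "tmul L (tors_triple n T)"])
    show "tmul L (tors_triple n T) \<in> pure_class e1 e2 e3 n L \<and> P (tmul L (tors_triple n T))"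
      using key T by (simp add: pure_class_def tors2_conv_tors_data)
  next
    fix R assume R: "R \<in> pure_class e1 e2 e3 n L \<and> P R"
    then obtain T' where T': "T' \<in> tors_data e1 e2 e3" "R = tmul L (tors_triple n T')"
      by (auto simp: pure_class_def tors2_conv_tors_data)
    hence "tors_triple 1 T' = tors_triple 1 T" using key R T by simp
    hence "T' = T" using inj_on_tors_triple(1)[OF e_nz e_sum no4] T T' by (meson inj_onD)
    thus "R = tmul L (tors_triple n T)" using T' by simp
  qed
  thus ?thesis unfolding P_def .
qed

end

section \<open>The matrix description\<close>

text \<open>As q does not divide x, p cannot divide both factors, so the correction n/p occurs
  equally often on the two sides.\<close>

lemma norm_symbol_mult_prime:
  fixes p q n x :: int
  assumes p: "prime p" "odd p" and q: "prime q" and qx: "\<not> q dvd x"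
  shows "norm_symbol n p (q * x) = norm_symbol n p q * norm_symbol n p x"
proof (cases "p = q")
  case True
  hence "q * x div p = x" "q div p = 1" using p by auto
  thus ?thesis using True qx p Legendre_mult[OF p] by (simp add: norm_symbol_def)
next
  case False
  hence pq: "\<not> p dvd q" using p q primes_dvd_imp_eq by blast
  show ?thesis
  proof (cases "p dvd x")
    case True
    hence "q * x div p = q * (x div p)" by (simp add: div_mult_swap)
    thus ?thesis using True pq p Legendre_mult[OF p] by (simp add: norm_symbol_def mult_ac)
  next
    case False
    thus ?thesis using pq p Legendre_mult[OF p] by (simp add: norm_symbol_def prime_dvd_mult_iff)
  qed
qed

lemma norm_symbol_1: "prime p \<Longrightarrow> norm_symbol n p 1 = 1"
  using not_prime_unit[of p] by (auto simp: norm_symbol_def Legendre_1)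

lemma even_sum_cong:
  fixes f g :: "'a \<Rightarrow> int"
  assumes "\<And>x. x \<in> A \<Longrightarrow> even (f x) = even (g x)"
  shows "even (sum f A) = even (sum g A)"
proof -
  have "even (sum f A - sum g A)"
    unfolding sum_subtractf[symmetric] by (rule dvd_sum) (use assms in auto)
  thus ?thesis by simp
qed

lemma prime_dvd_prod_list_primes:
  fixes ps :: "int list"
  assumes "prime p" "p dvd prod_list ps" "\<And>q. q \<in> set ps \<Longrightarrow> prime q"
  shows "p \<in> set ps"
  using assms(2,3)
proof (induction ps)
  case Nil
  thus ?case using assms(1) not_prime_unit by auto
next
  case (Cons q ps)
  thus ?case using assms(1) primes_dvd_imp_eq[of p q] by (auto simp: prime_dvd_mult_iff)
qed

locale square_twist_primes = square_twist +
  fixes ps :: "int list"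
  assumes ps_prod: "n = prod_list ps" and ps_distinct: "distinct ps" and ps_prime: "\<And>p. p \<in> set ps \<Longrightarrow> prime p"
begin

lemma in_set_ps_iff: "p \<in> set ps \<longleftrightarrow> prime p \<and> p dvd n"
proof
  assume "p \<in> set ps"
  thus "prime p \<and> p dvd n" using ps_prime ps_prod prod_list_dvd by blast
next
  assume "prime p \<and> p dvd n"
  thus "p \<in> set ps" using ps_prod ps_prime prime_dvd_prod_list_primes by blast
qed

lemma multiplicity_pos_divisor:
  assumes "prime p" "pos_divisor n d"
  shows "multiplicity p d = of_bool (p dvd d)"
  using multiplicity_squarefree[OF assms(1)] squarefree_mono[OF _ n_sf] assms(2)
  by (auto simp: pos_divisor_def)

text \<open>Row i of the matrix applied to the exponent vector of d adds up the symbols [p_j, -n] at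
  p_i over the primes p_j dividing d; by multiplicativity its parity is the symbol of d.\<close>

lemma norm_symbol_conv_matA:
  assumes i: "i < length ps" and d: "pos_divisor n d"
  shows "norm_symbol n (ps ! i) d =
     (if even (\<Sum>j<length ps. matA ps i j * of_bool (ps ! j dvd d)) then 1 else -1)"
  using d
proof (induction d rule: prime_divisors_induct)
  case zero
  thus ?case by (simp add: pos_divisor_def)
next
  case (unit d)
  hence "d = 1" by (auto simp: pos_divisor_def)
  moreover have "\<not> ps ! j dvd 1" if "j < length ps" for j
    using that ps_prime[of "ps ! j"] not_prime_unit nth_mem by blast
  ultimately show ?case using i ps_prime by (simp add: norm_symbol_1)
next
  case (factor q x)
  have q0: "q > 0" using factor.hyps prime_gt_0_int by blast
  have qd: "q dvd n" and xd: "pos_divisor n x"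
    using factor.prems q0 by (auto simp: pos_divisor_def zero_less_mult_iff dest: dvd_mult_left dvd_mult_right)
  have sf: "squarefree (q * x)" using factor.prems n_sf squarefree_mono by (auto simp: pos_divisor_def)
  have qx: "\<not> q dvd x"
  proof
    assume "q dvd x"
    hence "q^2 dvd q * x" by (simp add: power2_eq_square)
    thus False using squarefreeD[OF sf] factor.hyps not_prime_unit by blast
  qed
  have pi: "prime (ps ! i)" "ps ! i dvd n" using i in_set_ps_iff nth_mem by blast+
  have op: "odd (ps ! i)" using prime_dvd_odd pi by blast
  obtain l where l: "l < length ps" "q = ps ! l"
    using factor.hyps qd in_set_ps_iff by (metis in_set_conv_nth)
  \<comment> \<open>The new prime q = ps ! l does not divide x, and the entries are distinct, so it
    switches on exactly the coordinate l.\<close>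
  have eq: "matA ps i j * of_bool (ps ! j dvd q * x)
     = (if j = l then matA ps i j else 0) + matA ps i j * of_bool (ps ! j dvd x)" if "j < length ps" for j
  proof (cases "j = l")
    case True
    thus ?thesis using qx l by simp
  next
    case False
    hence "ps ! j \<noteq> q" using l that ps_distinct by (simp add: nth_eq_iff_index_eq)
    moreover have "prime (ps ! j)" using that ps_prime nth_mem by blast
    ultimately have "ps ! j dvd q * x \<longleftrightarrow> ps ! j dvd x"
      using factor.hyps primes_dvd_imp_eq by (auto simp: prime_dvd_mult_iff)
    thus ?thesis using False by simp
  qed
  have "(\<Sum>j<length ps. matA ps i j * of_bool (ps ! j dvd q * x))
      = (\<Sum>j<length ps. if j = l then matA ps i j else 0) + (\<Sum>j<length ps. matA ps i j * of_bool (ps ! j dvd x))"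
    unfolding sum.distrib[symmetric] by (intro sum.cong) (auto simp: eq)
  also have "(\<Sum>j<length ps. if j = l then matA ps i j else 0) = matA ps i l" using l by simp
  finally have S: "(\<Sum>j<length ps. matA ps i j * of_bool (ps ! j dvd q * x))
      = matA ps i l + (\<Sum>j<length ps. matA ps i j * of_bool (ps ! j dvd x))" .
  have "norm_symbol n (ps ! i) q = (if even (matA ps i l) then 1 else -1)"
    using norm_symbol_conv_hilbert_add[OF pi(1) op n_sf pi(2) factor.hyps] l ps_prod by (simp add: matA_def)
  moreover have "norm_symbol n (ps ! i) (q * x) = norm_symbol n (ps ! i) q * norm_symbol n (ps ! i) x"
    using pi op factor.hyps qx by (intro norm_symbol_mult_prime)
  ultimately show ?case unfolding S using factor.IH[OF xd] by simp
qed

lemma sum_matAA: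
  assumes i: "i < length ps"
  shows "(\<Sum>j<2 * length ps. matAA ps i j * z j) = (\<Sum>j<length ps. matA ps i j * z j)"
    and "(\<Sum>j<2 * length ps. matAA ps (length ps + i) j * z j)
       = (\<Sum>j<length ps. matA ps i j * z (length ps + j))"
proof -
  let ?k = "length ps"
  have "(\<Sum>j<a + b. f j) = (\<Sum>j<a. f j) + (\<Sum>j<b. f (a + j))" for a b and f :: "nat \<Rightarrow> int"
    by (induction b) (simp_all add: add.assoc)
  from this[of _ ?k ?k] have split: "(\<Sum>j<2 * ?k. f j) = (\<Sum>j<?k. f j) + (\<Sum>j<?k. f (?k + j))"
    for f :: "nat \<Rightarrow> int" by (simp only: mult_2)
  show "(\<Sum>j<2 * ?k. matAA ps i j * z j) = (\<Sum>j<?k. matA ps i j * z j)"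
    unfolding split using i by (simp add: matAA_def Let_def)
  show "(\<Sum>j<2 * ?k. matAA ps (?k + i) j * z j) = (\<Sum>j<?k. matA ps i j * z (?k + j))"
    unfolding split using i by (simp add: matAA_def Let_def)
qed

lemma kerAA_iff:
  "z \<in> kerAA ps \<longleftrightarrow> (\<forall>i. z i \<in> {0,1}) \<and> (\<forall>i\<ge>2*length ps. z i = 0) \<and>
     (\<forall>i<length ps. even (\<Sum>j<length ps. matA ps i j * z j) \<and>
        even (\<Sum>j<length ps. matA ps i j * z (length ps + j)))"
proof -
  let ?k = "length ps"
  have "(\<forall>i<2*?k. P i) \<longleftrightarrow> (\<forall>i<?k. P i \<and> P (?k + i))" for P
  proof (intro iffI allI impI)
    fix i assume h: "\<forall>i<?k. P i \<and> P (?k + i)" and i: "i < 2 * ?k"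
    show "P i"
    proof (cases "i < ?k")
      case False
      hence "i - ?k < ?k" using i by linarith
      hence "P (?k + (i - ?k))" using h by blast
      thus ?thesis using False by simp
    qed (use h in simp)
  qed auto
  thus ?thesis unfolding kerAA_def by (simp add: sum_matAA)
qed

lemma vecmap_pos_divisor:
  assumes d: "pos_divisor n d1" "pos_divisor n d2" and j: "j < length ps"
  shows "vecmap ps (d1, d2, d3) j = of_bool (ps ! j dvd d1)"
    and "vecmap ps (d1, d2, d3) (length ps + j) = of_bool (ps ! j dvd d2)"
  using j d ps_prime[of "ps ! j"] by (simp_all add: vecmap_def multiplicity_pos_divisor)

lemma vecmap_in_kerAA_iff:
  assumes d: "pos_divisor n d1" "pos_divisor n d2"
  shows "vecmap ps (d1, d2, d3) \<in> kerAA ps \<longleftrightarrow>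
    (\<forall>p. prime p \<longrightarrow> p dvd n \<longrightarrow> norm_symbol n p d1 = 1 \<and> norm_symbol n p d2 = 1)"
proof -
  have "vecmap ps (d1, d2, d3) i \<in> {0,1}" for i by (auto simp: vecmap_def)
  moreover have "vecmap ps (d1, d2, d3) i = 0" if "i \<ge> 2 * length ps" for i using that by (simp add: vecmap_def)
  moreover have "(\<forall>p. prime p \<longrightarrow> p dvd n \<longrightarrow> norm_symbol n p d1 = 1 \<and> norm_symbol n p d2 = 1) \<longleftrightarrow>
     (\<forall>i<length ps. norm_symbol n (ps ! i) d1 = 1 \<and> norm_symbol n (ps ! i) d2 = 1)"
    using in_set_ps_iff by (metis in_set_conv_nth)
  moreover have "even (\<Sum>j<length ps. matA ps i j * vecmap ps (d1, d2, d3) j) \<longleftrightarrow> norm_symbol n (ps ! i) d1 = 1"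
     "even (\<Sum>j<length ps. matA ps i j * vecmap ps (d1, d2, d3) (length ps + j)) \<longleftrightarrow> norm_symbol n (ps ! i) d2 = 1"
    if "i < length ps" for i
    using norm_symbol_conv_matA[OF that d(1)] norm_symbol_conv_matA[OF that d(2)]
    by (simp_all add: vecmap_pos_divisor[OF d])
  ultimately show ?thesis
    unfolding kerAA_iff by simp
qed

lemma Sel2_iff_vecmap:
  assumes "pos_divisor n d1" "pos_divisor n d2" "pos_divisor n d3" "d1 * d2 * d3 = s^2"
  shows "(d1, d2, d3) \<in> Sel2 e1 e2 e3 n \<longleftrightarrow> vecmap ps (d1, d2, d3) \<in> kerAA ps"
  using Sel2_pos_divisor_iff[OF assms] vecmap_in_kerAA_iff[OF assms(1,2)] by simp

lemma pos_divisor_eqI: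
  assumes d: "pos_divisor n d" "pos_divisor n d'"
    and eq: "\<And>j. j < length ps \<Longrightarrow> ps ! j dvd d \<longleftrightarrow> ps ! j dvd d'"
  shows "d = d'"
proof (rule int_eq_multiplicityI)
  show "d \<noteq> 0" "d' \<noteq> 0" "sgn d = sgn d'" using d by (auto simp: pos_divisor_def)
  fix p :: int assume p: "prime p"
  have "p dvd d \<longleftrightarrow> p dvd d'"
  proof (cases "p dvd n")
    case True
    thus ?thesis using p eq in_set_ps_iff by (metis in_set_conv_nth)
  next
    case False
    thus ?thesis using d by (meson dvd_trans pos_divisor_def)
  qed
  thus "multiplicity p d = multiplicity p d'" using multiplicity_pos_divisor p d by simp
qed

text \<open>This is why \<open>vecmap\<close> may forget the third entry.\<close>

lemma pos_divisor_third:
  assumes d: "pos_divisor n d1" "pos_divisor n d2" "pos_divisor n d3" and s: "d1 * d2 * d3 = s^2"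
  shows "d3 = sqcl (d1 * d2)"
proof -
  have nz: "d1 \<noteq> 0" "d2 \<noteq> 0" "d3 \<noteq> 0" using d by (auto simp: pos_divisor_def)
  have "squarefree d3" using d n_sf squarefree_mono by (auto simp: pos_divisor_def)
  hence "d3 = sqcl d3" by (simp add: sqcl_squarefree)
  also have "\<dots> = sqcl (d1 * d2)" using nz s by (intro sqcl_eqI[of _ _ s]) (auto simp: mult_ac)
  finally show ?thesis .
qed

lemma exists_pos_divisor:
  fixes z :: "nat \<Rightarrow> int"
  shows "\<exists>d. pos_divisor n d \<and> (\<forall>j<length ps. ps ! j dvd d \<longleftrightarrow> z j = 1)"
proof -
  define J where "J = {j\<in>{0..<length ps}. z j = 1}"
  define d where "d = (\<Prod>j\<in>J. ps ! j)"
  have J: "finite J" "J \<subseteq> {0..<length ps}" by (auto simp: J_def)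
  have pr: "prime (ps ! j)" if "j < length ps" for j using that ps_prime by simp
  have "d > 0" unfolding d_def using J pr prime_gt_0_int by (intro prod_pos) auto
  moreover have "d dvd n"
    unfolding d_def ps_prod prod.list_conv_set_nth using J by (intro prod_dvd_prod_subset) auto
  moreover have "ps ! j dvd d \<longleftrightarrow> z j = 1" if j: "j < length ps" for j
  proof -
    have "ps ! j dvd d \<longleftrightarrow> (\<exists>i\<in>J. ps ! j dvd ps ! i)"
      unfolding d_def using prime_dvd_prod_iff[OF J(1) pr[OF j]] .
    also have "\<dots> \<longleftrightarrow> (\<exists>i\<in>J. j = i)"
    proof (rule bex_cong[OF refl])
      fix i assume "i \<in> J"
      hence i: "i < length ps" by (simp add: J_def)
      show "ps ! j dvd ps ! i \<longleftrightarrow> j = i"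
        using primes_dvd_imp_eq[OF pr[OF j] pr[OF i]] ps_distinct i j by (auto simp: nth_eq_iff_index_eq)
    qed
    also have "\<dots> \<longleftrightarrow> z j = 1" using j by (auto simp: J_def)
    finally show ?thesis .
  qed
  ultimately show ?thesis by (auto simp: pos_divisor_def)
qed

lemma bij_betw_vecmap:
  "bij_betw (vecmap ps)
     {R\<in>Sel2 e1 e2 e3 n. case R of (d1,d2,d3) \<Rightarrow> pos_divisor n d1 \<and> pos_divisor n d2 \<and> pos_divisor n d3} (kerAA ps)"
  (is "bij_betw _ ?S _")
proof -
  have mem: "\<exists>s. d1 * d2 * d3 = s^2" "pos_divisor n d1" "pos_divisor n d2" "pos_divisor n d3"
      "(d1, d2, d3) \<in> Sel2 e1 e2 e3 n"
    if "(d1, d2, d3) \<in> ?S" for d1 d2 d3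
    using that by (auto simp: Sel2_def)
  have inj: "inj_on (vecmap ps) ?S"
  proof (rule inj_onI)
    fix R R' assume R: "R \<in> ?S" and R': "R' \<in> ?S" and eq': "vecmap ps R = vecmap ps R'"
    obtain a1 a2 a3 where Ra: "R = (a1, a2, a3)" by (cases R)
    obtain b1 b2 b3 where Rb: "R' = (b1, b2, b3)" by (cases R')
    note a = mem(2-4)[OF R[unfolded Ra]] and b = mem(2-4)[OF R'[unfolded Rb]]
    note eq = eq'[unfolded Ra Rb]
    obtain s t where s: "a1 * a2 * a3 = s^2" and t: "b1 * b2 * b3 = t^2"
      using mem(1)[OF R[unfolded Ra]] mem(1)[OF R'[unfolded Rb]] by blast
    have "ps ! j dvd a1 \<longleftrightarrow> ps ! j dvd b1" "ps ! j dvd a2 \<longleftrightarrow> ps ! j dvd b2" if "j < length ps" for j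
      using vecmap_pos_divisor[OF a(1,2) that, of a3] vecmap_pos_divisor[OF b(1,2) that, of b3] eq
      by (simp_all add: of_bool_eq_iff)
    hence "a1 = b1" "a2 = b2" using pos_divisor_eqI a b by blast+
    moreover have "a3 = b3" using pos_divisor_third[OF a s] pos_divisor_third[OF b t] calculation by simp
    ultimately show "R = R'" by (simp add: Ra Rb)
  qed
  have sub: "vecmap ps R \<in> kerAA ps" if R: "R \<in> ?S" for R
  proof -
    obtain d1 d2 d3 where Rd: "R = (d1, d2, d3)" by (cases R)
    note m = mem[OF R[unfolded Rd]]
    obtain s where "d1 * d2 * d3 = s^2" using m(1) by blast
    from Sel2_iff_vecmap[OF m(2-4) this] m(5) show ?thesis unfolding Rd by simp
  qed
  have sup: "z \<in> vecmap ps ` ?S" if z: "z \<in> kerAA ps" for z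
  proof -
    obtain d1 where d1: "pos_divisor n d1" "\<And>j. j < length ps \<Longrightarrow> ps ! j dvd d1 \<longleftrightarrow> z j = 1"
      using exists_pos_divisor[of z] by blast
    obtain d2 where d2: "pos_divisor n d2" "\<And>j. j < length ps \<Longrightarrow> ps ! j dvd d2 \<longleftrightarrow> z (length ps + j) = 1"
      using exists_pos_divisor[of "\<lambda>j. z (length ps + j)"] by blast
    \<comment> \<open>The only possible choice, since d1 d2 d3 has to be a square.\<close>
    define d3 where "d3 = sqcl (d1 * d2)"
    have d3: "pos_divisor n d3" unfolding d3_def using pos_divisor_sqcl_mult n_pos d1 d2 by blast
    have "d1 * d2 \<noteq> 0" using d1 d2 by (auto simp: pos_divisor_def)
    then obtain s where "d1 * d2 = d3 * s^2" using sqcl_decompose unfolding d3_def by metis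
    hence sq: "d1 * d2 * d3 = (d3 * s)^2" by (simp add: power2_eq_square)
    have V: "vecmap ps (d1, d2, d3) = z"
    proof
      fix i
      have zi: "z i = 0 \<or> z i = 1" and z0: "i \<ge> 2 * length ps \<Longrightarrow> z i = 0" using z by (auto simp: kerAA_def)
      consider "i < length ps" | j where "i = length ps + j" "j < length ps" | "i \<ge> 2 * length ps"
        by (metis add_diff_inverse_nat linorder_not_less mult_2 nat_add_left_cancel_less)
      thus "vecmap ps (d1, d2, d3) i = z i"
      proof cases
        case 1
        thus ?thesis using vecmap_pos_divisor(1)[OF d1(1) d2(1) 1] d1(2) zi by auto
      next
        case 2
        thus ?thesis using vecmap_pos_divisor(2)[OF d1(1) d2(1) 2(2)] d2(2) zi by auto
      next
        case 3
        thus ?thesis using z0 by (simp add: vecmap_def)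
      qed
    qed
    have "(d1, d2, d3) \<in> ?S"
      using Sel2_iff_vecmap[OF d1(1) d2(1) d3 sq] V z d1 d2 d3 by simp
    thus ?thesis unfolding V[symmetric] by (rule imageI)
  qed
  from inj show ?thesis
  proof (rule bij_betw_imageI)
    show "vecmap ps ` ?S = kerAA ps"
      using sub sup by (intro equalityI image_subsetI subsetI)
  qed
qed

lemma kerAA_F2add:
  assumes z: "z \<in> kerAA ps" and w: "w \<in> kerAA ps"
  shows "F2add z w \<in> kerAA ps"
proof -
  have "even (\<Sum>j<2*length ps. matAA ps i j * F2add z w j)" if "i < 2 * length ps" for i
  proof -
    \<comment> \<open>Reducing z + w modulo 2 coordinatewise changes the row sum by an even
      number.\<close>
    have "even (\<Sum>j<2*length ps. matAA ps i j * F2add z w j)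
        = even (\<Sum>j<2*length ps. matAA ps i j * z j + matAA ps i j * w j)"
      by (rule even_sum_cong) (auto simp: F2add_def)
    thus ?thesis using z w that by (simp add: sum.distrib kerAA_def)
  qed
  thus ?thesis using z w by (auto simp: kerAA_def F2add_def)
qed

text \<open>Valuations add, and \<open>sqcl\<close> reduces them modulo 2, which gives additivity.
  Membership of the product is then read off the kernel, where closure is linear, and carried back
  by \<open>Sel2_iff_vecmap\<close>.\<close>

lemma tmul_pos_divisor:
  assumes R: "(a1, a2, a3) \<in> Sel2 e1 e2 e3 n" "(b1, b2, b3) \<in> Sel2 e1 e2 e3 n"
    and a: "pos_divisor n a1" "pos_divisor n a2" "pos_divisor n a3"
    and b: "pos_divisor n b1" "pos_divisor n b2" "pos_divisor n b3"
  shows "vecmap ps (tmul (a1, a2, a3) (b1, b2, b3)) = F2add (vecmap ps (a1, a2, a3)) (vecmap ps (b1, b2, b3))"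
    and "tmul (a1, a2, a3) (b1, b2, b3) \<in> Sel2 e1 e2 e3 n"
proof -
  have nz: "a1 \<noteq> 0" "a2 \<noteq> 0" "a3 \<noteq> 0" "b1 \<noteq> 0" "b2 \<noteq> 0" "b3 \<noteq> 0" using a b by (auto simp: pos_divisor_def)
  obtain s t where s: "a1 * a2 * a3 = s^2" and t: "b1 * b2 * b3 = t^2" using R by (auto simp: Sel2_def)
  have mult: "int (multiplicity p (sqcl (x * y)) mod 2) = (int (multiplicity p x mod 2) + int (multiplicity p y mod 2)) mod 2"
    if "prime p" "x \<noteq> 0" "y \<noteq> 0" for p x y
    using that prime_imp_prime_elem[OF that(1)]
    by (simp add: multiplicity_sqcl prime_elem_multiplicity_mult_distrib zmod_int mod_simps)
  show V: "vecmap ps (tmul (a1, a2, a3) (b1, b2, b3)) = F2add (vecmap ps (a1, a2, a3)) (vecmap ps (b1, b2, b3))"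
  proof
    fix i
    consider "i < length ps" | "\<not> i < length ps" "i < 2 * length ps" | "i \<ge> 2 * length ps" by linarith
    thus "vecmap ps (tmul (a1, a2, a3) (b1, b2, b3)) i = F2add (vecmap ps (a1, a2, a3)) (vecmap ps (b1, b2, b3)) i"
    proof cases
      case 1
      hence "prime (ps ! i)" using ps_prime by simp
      thus ?thesis using 1 mult nz by (simp add: vecmap_def tmul_def F2add_def)
    next
      case 2
      hence "prime (ps ! (i - length ps))" using ps_prime by simp
      thus ?thesis using 2 mult nz by (simp add: vecmap_def tmul_def F2add_def)
    next
      case 3
      thus ?thesis by (simp add: vecmap_def tmul_def F2add_def)
    qed
  qed
  define c1 c2 c3 where c: "c1 = sqcl (a1 * b1)" "c2 = sqcl (a2 * b2)" "c3 = sqcl (a3 * b3)"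
  obtain r1 where r1: "r1 \<noteq> 0" "a1 * b1 = c1 * r1^2" using sqcl_decompose[of "a1 * b1"] nz unfolding c by auto
  obtain r2 where r2: "r2 \<noteq> 0" "a2 * b2 = c2 * r2^2" using sqcl_decompose[of "a2 * b2"] nz unfolding c by auto
  obtain r3 where r3: "r3 \<noteq> 0" "a3 * b3 = c3 * r3^2" using sqcl_decompose[of "a3 * b3"] nz unfolding c by auto
  have "(r1 * r2 * r3)^2 * (c1 * c2 * c3) = (c1 * r1^2) * (c2 * r2^2) * (c3 * r3^2)"
    by (simp add: power2_eq_square mult_ac)
  also have "\<dots> = (a1 * b1) * (a2 * b2) * (a3 * b3)" by (simp only: r1 r2 r3)
  also have "\<dots> = (a1 * a2 * a3) * (b1 * b2 * b3)" by (simp add: mult_ac)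
  also have "\<dots> = (s * t)^2" unfolding s t by (simp add: power_mult_distrib)
  finally have "is_square ((r1 * r2 * r3)^2 * (c1 * c2 * c3))" by (rule is_nth_powerI)
  hence "is_square (c1 * c2 * c3)" using r1 r2 r3 by (simp add: is_nth_power_mult_cancel_left)
  then obtain q where q: "c1 * c2 * c3 = q^2" by (elim is_nth_powerE)
  have cd: "pos_divisor n c1" "pos_divisor n c2" "pos_divisor n c3"
    unfolding c using pos_divisor_sqcl_mult n_pos a b by blast+
  have "vecmap ps (a1, a2, a3) \<in> kerAA ps" "vecmap ps (b1, b2, b3) \<in> kerAA ps"
    using R Sel2_iff_vecmap a b s t by blast+
  hence "vecmap ps (c1, c2, c3) \<in> kerAA ps"
    using kerAA_F2add V by (simp add: tmul_def c)
  thus "tmul (a1, a2, a3) (b1, b2, b3) \<in> Sel2 e1 e2 e3 n"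
    using Sel2_iff_vecmap[OF cd q] by (simp add: tmul_def c)
qed

end

theorem theorem2p6:
  fixes e1 e2 e3 :: int and ps :: "int list" and n :: int
  assumes "e1 \<noteq> 0" "e2 \<noteq> 0" "e3 \<noteq> 0" "e1 + e2 + e3 = 0"
    and "gcd e1 (gcd e2 e3) \<in> {1, 2}"
    and "n = prod_list ps" and "distinct ps" and "\<forall>p\<in>set ps. prime p"
    and "odd n" and "n > 0" and "squarefree n"
    and "coprime n (e1 * e2 * e3)"
    and "\<forall>p\<in>set ps. \<forall>q::int. prime q \<and> odd q \<and> q dvd e1 * e2 * e3 \<longrightarrow> QuadRes q p"
    and "\<not> has_rat_point_order4 e1 e2 1" and "\<not> has_rat_point_order4 e1 e2 n"
    and "\<forall>p\<in>set ps. [p = 1] (mod 8)"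
    and "card (Sel2 e1 e2 e3 1) = 4"
  shows "(\<forall>L\<in>Sel2 e1 e2 e3 n. \<exists>!R. R \<in> pure_class e1 e2 e3 n L \<and>
            (case R of (d1,d2,d3) \<Rightarrow> d1 > 0 \<and> d1 dvd n \<and> d2 > 0 \<and> d2 dvd n \<and> d3 > 0 \<and> d3 dvd n))
       \<and> bij_betw (vecmap ps)
           {R\<in>Sel2 e1 e2 e3 n. case R of (d1,d2,d3) \<Rightarrow>
               d1 > 0 \<and> d1 dvd n \<and> d2 > 0 \<and> d2 dvd n \<and> d3 > 0 \<and> d3 dvd n}
           (kerAA ps)
       \<and> (\<forall>R\<in>Sel2 e1 e2 e3 n. \<forall>R'\<in>Sel2 e1 e2 e3 n.
            (case R of (d1,d2,d3) \<Rightarrow> d1 > 0 \<and> d1 dvd n \<and> d2 > 0 \<and> d2 dvd n \<and> d3 > 0 \<and> d3 dvd n) \<longrightarrow>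
            (case R' of (d1,d2,d3) \<Rightarrow> d1 > 0 \<and> d1 dvd n \<and> d2 > 0 \<and> d2 dvd n \<and> d3 > 0 \<and> d3 dvd n) \<longrightarrow>
            tmul R R' \<in> Sel2 e1 e2 e3 n \<and>
            vecmap ps (tmul R R') = F2add (vecmap ps R) (vecmap ps R'))"
proof -
  \<comment> \<open>This turns the hypotheses on the list entries into hypotheses on all prime
    divisors of n, as the locale requires.\<close>
  have ps: "p \<in> set ps" if "prime p" "p dvd n" for p
    using that assms(6,8) prime_dvd_prod_list_primes by blast
  interpret square_twist_primes e1 e2 e3 n ps
    using assms ps by unfold_locales auto
  have P: "(case R of (d1,d2,d3) \<Rightarrow> d1 > 0 \<and> d1 dvd n \<and> d2 > 0 \<and> d2 dvd n \<and> d3 > 0 \<and> d3 dvd n) \<longleftrightarrow>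
      (case R of (d1,d2,d3) \<Rightarrow> pos_divisor n d1 \<and> pos_divisor n d2 \<and> pos_divisor n d3)" for R
    by (simp add: pos_divisor_def split: prod.split)
  show ?thesis
    unfolding P
  proof (intro conjI)
    show "\<forall>L\<in>Sel2 e1 e2 e3 n. \<exists>!R. R \<in> pure_class e1 e2 e3 n L \<and>
       (case R of (d1,d2,d3) \<Rightarrow> pos_divisor n d1 \<and> pos_divisor n d2 \<and> pos_divisor n d3)"
      using pure_class_representative assms by blast
  qed (use bij_betw_vecmap tmul_pos_divisor in auto)
qed

end
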